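(* Let $a,b,c,\hat a,\hat b,\hat c$ be real constants with $c,\hat c>0$, and let $u(x,t)$, $\hat u(x,t)$ be the solutions of $$u_t+a\,u_x+b\,u\,u_x=c\,u_{xx},\qquad \hat u_t+\hat a\,\hat u_x+\hat b\,\hat u\,\hat u_x=\hat c\,\hat u_{xx}\qquad(x\in\mathbf R,\ t>0),$$ respectively, corresponding to initial states $u_0,\hat u_0\in L^1(\mathbf R)$ with the same mass $m\neq0$, that is, $\int_{-\infty}^{+\infty}u_0(x)\,dx=\int_{-\infty}^{+\infty}\hat u_0(x)\,dx=m\ne0$. Then the following statements are equivalent: (i) $(a,b,c)=(\hat a,\hat b,\hat c)$; (ii) $\displaystyle \liminf_{t\to\infty}\;t^{\frac12\left(1-\frac1p\right)}\|u(\cdot,t)-\hat u(\cdot,t)\|_p=0$ for some $1\le p\le\infty$; (iii) $\displaystyle \lim_{t\to\infty}\;t^{\frac12\left(1-\frac1p\right)}\|u(\cdot,t)-\hat u(\cdot,t)\|_p=0$ for all $1\le p\le\infty$.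
   Context: Functions are real-valued. For fixed $t$, $\|v(\cdot,t)\|_p$ denotes the $L^p(\mathbf R)$ norm of $x\mapsto v(x,t)$: $\left(\int_{-\infty}^{+\infty}|v(x,t)|^p\,dx\right)^{1/p}$ if $1\le p<\infty$, and $\sup_{x\in\mathbf R}|v(x,t)|$ if $p=\infty$; $1/p=0$ when $p=\infty$. Initial conditions are meant in the sense that $\|u(\cdot,t)-u_0\|_1\to0$ as $t\to0$, $t>0$. The solution of $u_t+a\,u_x+b\,u\,u_x=c\,u_{xx}$ with initial state $u_0\in L^1(\mathbf R)$ is given, for $t>0$, by $$u(x,t)=\frac1{\sqrt{4\pi ct}}\,\frac1{\varphi(x,t)}\int_{-\infty}^{+\infty}e^{-\frac{(x-y-at)^2}{4ct}}\,\varphi_0(y)\,u_0(y)\,dy,\qquad \varphi(x,t)=\frac1{\sqrt{4\pi ct}}\int_{-\infty}^{+\infty}e^{-\frac{(x-y-at)^2}{4ct}}\,\varphi_0(y)\,dy,$$ with $\varphi_0(x)=\exp\left(-\frac{b}{2c}\int_{-\infty}^x u_0(\xi)\,d\xi\right)$ (for $b=0$ one has $\varphi_0\equiv\varphi\equiv1$); similarly for $\hat u$ with $\hat a,\hat b,\hat c,\hat u_0$. *)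

theory Defs
  imports "HOL-Analysis.Analysis"
begin

text \<open>
  The \<open>L\<^sup>p\<close> norm on the real line for \<open>1 \<le> p \<le> \<infinity>\<close>, with values in the extended nonnegative
  reals so that functions outside \<open>L\<^sup>p\<close> get norm \<open>\<infinity>\<close>. For \<open>p = \<infinity>\<close> it is the supremum, not the
  essential supremum; the two agree on continuous functions.
\<close>

definition Lp_norm :: "ennreal \<Rightarrow> (real \<Rightarrow> real) \<Rightarrow> ennreal" where
  "Lp_norm p v =
     (if p = \<infinity> then (SUP x. ennreal \<bar>v x\<bar>)
      else let I = (\<integral>\<^sup>+ x. ennreal (\<bar>v x\<bar> powr enn2real p) \<partial>lborel)
           in if I = \<infinity> then \<infinity> else ennreal (enn2real I powr (1 / enn2real p)))"

definition cole_hopf_init :: "real \<Rightarrow> real \<Rightarrow> (real \<Rightarrow> real) \<Rightarrow> real \<Rightarrow> real" where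
  "cole_hopf_init b c u0 x = exp (- (b / (2 * c)) * (LINT \<xi>:{..x}|lborel. u0 \<xi>))"

definition cole_hopf_phi ::
  "real \<Rightarrow> real \<Rightarrow> real \<Rightarrow> (real \<Rightarrow> real) \<Rightarrow> real \<Rightarrow> real \<Rightarrow> real" where
  "cole_hopf_phi a b c u0 x t =
     1 / sqrt (4 * pi * c * t) *
     (LINT y|lborel. exp (- ((x - y - a * t)\<^sup>2 / (4 * c * t))) * cole_hopf_init b c u0 y)"

definition cole_hopf ::
  "real \<Rightarrow> real \<Rightarrow> real \<Rightarrow> (real \<Rightarrow> real) \<Rightarrow> real \<Rightarrow> real \<Rightarrow> real" where
  "cole_hopf a b c u0 x t =
     1 / sqrt (4 * pi * c * t) * (1 / cole_hopf_phi a b c u0 x t) *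
     (LINT y|lborel. exp (- ((x - y - a * t)\<^sup>2 / (4 * c * t))) * cole_hopf_init b c u0 y * u0 y)"

definition solves_burgers :: "real \<Rightarrow> real \<Rightarrow> real \<Rightarrow> (real \<Rightarrow> real \<Rightarrow> real) \<Rightarrow> bool" where
  "solves_burgers a b c u \<longleftrightarrow>
     (\<exists>ut ux uxx. \<forall>x t. t > 0 \<longrightarrow>
        ((\<lambda>s. u x s) has_real_derivative ut x t) (at t) \<and>
        ((\<lambda>y. u y t) has_real_derivative ux x t) (at x) \<and>
        ((\<lambda>y. ux y t) has_real_derivative uxx x t) (at x) \<and>
        ut x t + a * ux x t + b * u x t * ux x t = c * uxx x t)"

definition has_initial_state :: "(real \<Rightarrow> real \<Rightarrow> real) \<Rightarrow> (real \<Rightarrow> real) \<Rightarrow> bool" where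
  "has_initial_state u u0 \<longleftrightarrow> ((\<lambda>t. Lp_norm 1 (\<lambda>x. u x t - u0 x)) \<longlongrightarrow> 0) (at_right 0)"

text \<open>
  Continuity of \<open>t \<mapsto> u(\<cdot>,t)\<close> in \<open>L\<^sup>1\<close> at positive times is not part of the first two conditions, so
  they are not used as a uniqueness class; \<^emph>\<open>the\<close> solution with initial state \<open>u0\<close> is the one given by
  the Cole--Hopf formula. For integrable \<open>u0\<close> and \<open>c > 0\<close> the function given by the formula
  satisfies the first two conditions; values of \<open>u x t\<close> at \<open>t \<le> 0\<close> are irrelevant.
\<close>

definition is_burgers_solution ::
  "real \<Rightarrow> real \<Rightarrow> real \<Rightarrow> (real \<Rightarrow> real) \<Rightarrow> (real \<Rightarrow> real \<Rightarrow> real) \<Rightarrow> bool" where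
  "is_burgers_solution a b c u0 u \<longleftrightarrow>
     solves_burgers a b c u \<and> has_initial_state u u0 \<and>
     (\<forall>x t. t > 0 \<longrightarrow> u x t = cole_hopf a b c u0 x t)"

text \<open>
  The factor \<open>t\<close> to the power \<open>(1 - 1/p)/2\<close> times the \<open>L\<^sup>p\<close> distance at time \<open>t\<close>; the inverse is
  taken in the extended nonnegative reals, hence is \<open>0\<close> for \<open>p = \<infinity>\<close>.
\<close>

definition scaled_Lp_dist ::
  "ennreal \<Rightarrow> (real \<Rightarrow> real \<Rightarrow> real) \<Rightarrow> (real \<Rightarrow> real \<Rightarrow> real) \<Rightarrow> real \<Rightarrow> ennreal" where
  "scaled_Lp_dist p u v t =
     ennreal (t powr (1 / 2 * (1 - enn2real (inverse p)))) * Lp_norm p (\<lambda>x. u x t - v x t)"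

end

theory Submission
  imports Defs "HOL-Probability.Distributions"
begin

text \<open>
  Let \<open>r = sqrt t\<close>. In the moving coordinate \<open>x = a t + \<xi> r\<close>, the function \<open>r u\<close> is by the Cole--Hopf
  formula a quotient: its numerator \<open>\<integral> exp (- (\<xi> - y / r)\<^sup>2 / (4 c)) \<phi>\<^sub>0 y u\<^sub>0 y dy\<close> tends to
  \<open>\<integral> \<phi>\<^sub>0 u\<^sub>0\<close> times the Gaussian, and its denominator is a Gaussian average of \<open>\<phi>\<^sub>0 (z r)\<close>, a function
  that tends to a step from \<open>1\<close> to \<open>exp (- b m / (2 c))\<close>. So \<open>r u\<close> tends to an explicit profile, the
  diffusion wave. The convergence is uniform (\<open>rescaled_solution_uniform\<close>) and in \<open>L\<^sup>1\<close>
  (\<open>rescaled_solution_L1\<close>). The profile depends on \<open>b\<close>, \<open>c\<close> and the mass \<open>m\<close> only, because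
  \<open>\<integral> \<phi>\<^sub>0 u\<^sub>0 = (2 c / b) (1 - exp (- b m / (2 c)))\<close> by \<open>integral_exp_primitive\<close>.

  The weight in the scaled distance turns the \<open>L\<^sup>p\<close> norm in \<open>x\<close> into the plain \<open>L\<^sup>p\<close> norm in \<open>\<xi>\<close>
  (\<open>scaled_Lp_dist_rescale\<close>). If the parameters agree, both solutions have the same profile in the same
  frame, and uniform and \<open>L\<^sup>1\<close> convergence together give convergence for every \<open>p\<close>
  (\<open>rescaled_solution_diff_Lp_tendsto_0\<close>).

  Conversely, if the parameters differ, the two profiles stay apart by a fixed amount on a fixed
  interval for all large times (\<open>diffusion_waves_separate\<close>), which bounds the distance from below for
  every \<open>p\<close>. For \<open>a \<noteq> a'\<close> the waves drift apart. For \<open>a = a'\<close> the profiles are different functions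
  (\<open>diffusion_wave_determines_parameters\<close>): the Gaussian decay rate determines \<open>c\<close>, and the ratio of the
  two tail amplitudes is \<open>exp (b m / (2 c))\<close>, which determines \<open>b\<close> since \<open>m \<noteq> 0\<close>.
\<close>

section \<open>Integrals of exponentials of a primitive\<close>

abbreviation primitive :: "(real \<Rightarrow> real) \<Rightarrow> real \<Rightarrow> real" where
  "primitive f x \<equiv> LINT \<xi>:{..x}|lborel. f \<xi>"

lemma primitive_at_top:
  assumes "integrable lborel (f :: real \<Rightarrow> real)"
  shows "(primitive f \<longlongrightarrow> (LINT x|lborel. f x)) at_top"
  using tendsto_integral_at_top[OF _ assms] by (simp add: set_lebesgue_integral_def)

lemma primitive_at_bot:
  assumes f: "integrable lborel (f :: real \<Rightarrow> real)"
  shows "(primitive f \<longlongrightarrow> 0) at_bot"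
proof -
  have [measurable]: "f \<in> borel_measurable borel" using f by auto
  have "((\<lambda>t. LINT y|lborel. indicator {..-t} y *\<^sub>R f y) \<longlongrightarrow> integral\<^sup>L lborel (\<lambda>y::real. 0::real)) at_top"
  proof (rule integral_dominated_convergence_at_top[where w="\<lambda>y. \<bar>f y\<bar>"])
    show "AE y in lborel. ((\<lambda>t. indicator {..-t} y *\<^sub>R f y) \<longlongrightarrow> 0) at_top"
    proof (rule AE_I2)
      fix y :: real
      have "eventually (\<lambda>t. indicator {..-t} y *\<^sub>R f y = 0) at_top"
        using eventually_gt_at_top[of "-y"] by eventually_elim (auto simp: indicator_def)
      then show "((\<lambda>t. indicator {..-t} y *\<^sub>R f y) \<longlongrightarrow> 0) at_top"
        by (rule tendsto_eventually)
    qed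
    show "eventually (\<lambda>t. AE y in lborel. norm (indicator {..-t} y *\<^sub>R f y) \<le> \<bar>f y\<bar>) at_top"
      by (intro always_eventually allI AE_I2) (auto simp: indicator_def)
  qed (use f in auto)
  then show ?thesis
    by (simp add: filterlim_at_bot_mirror set_lebesgue_integral_def)
qed

lemma isCont_primitive:
  assumes f: "integrable lborel (f :: real \<Rightarrow> real)"
  shows "isCont (primitive f) a"
  unfolding continuous_at_sequentially comp_def
proof (intro allI impI)
  fix X :: "nat \<Rightarrow> real" assume X: "X \<longlonglongrightarrow> a"
  have [measurable]: "f \<in> borel_measurable borel" using f by auto
  show "(\<lambda>n. primitive f (X n)) \<longlonglongrightarrow> primitive f a"
    unfolding set_lebesgue_integral_def
  proof (rule integral_dominated_convergence[where w="\<lambda>y. \<bar>f y\<bar>"])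
    show "AE y in lborel. (\<lambda>n. indicator {..X n} y *\<^sub>R f y) \<longlonglongrightarrow> indicator {..a} y *\<^sub>R f y"
      using AE_lborel_singleton[of a]
    proof eventually_elim
      fix y assume "y \<noteq> a"
      then consider "y < a" | "y > a" by linarith
      then have "eventually (\<lambda>n. indicator {..X n} y *\<^sub>R f y = indicator {..a} y *\<^sub>R f y) sequentially"
      proof cases
        case 1
        show ?thesis using order_tendstoD(1)[OF X 1]
          by eventually_elim (use 1 in \<open>auto simp: indicator_def\<close>)
      next
        case 2
        show ?thesis using order_tendstoD(2)[OF X 2]
          by eventually_elim (use 2 in \<open>auto simp: indicator_def\<close>)
      qed
      then show "(\<lambda>n. indicator {..X n} y *\<^sub>R f y) \<longlonglongrightarrow> indicator {..a} y *\<^sub>R f y"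
        by (rule tendsto_eventually)
    qed
  qed (use f in \<open>auto simp: indicator_def\<close>)
qed

lemma primitive_diff:
  assumes f: "integrable lborel (f :: real \<Rightarrow> real)" and "x \<le> y"
  shows "primitive f y - primitive f x = (LINT \<xi>:{x<..y}|lborel. f \<xi>)"
proof -
  have i: "set_integrable lborel A f" if "A \<in> sets lborel" for A
    using f that unfolding set_integrable_def by (rule integrable_mult_indicator[rotated])
  have "{..y} = {..x} \<union> {x<..y}" using assms by auto
  then have "primitive f y = primitive f x + (LINT \<xi>:{x<..y}|lborel. f \<xi>)"
    using set_integral_Un[OF _ i i, of "{..x}" "{x<..y}"] by fastforce
  then show ?thesis by simp
qed

lemma primitive_bound:
  assumes f: "integrable lborel (f :: real \<Rightarrow> real)"
  shows "\<bar>primitive f x\<bar> \<le> (LINT x|lborel. \<bar>f x\<bar>)"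
proof -
  have "\<bar>primitive f x\<bar> \<le> (LINT y|lborel. norm (indicator {..x} y *\<^sub>R f y))"
    unfolding set_lebesgue_integral_def using integral_norm_bound real_norm_def by metis
  also have "\<dots> \<le> (LINT x|lborel. \<bar>f x\<bar>)"
    by (rule integral_mono, intro integrable_norm integrable_mult_indicator)
      (use f in \<open>auto simp: indicator_def\<close>)
  finally show ?thesis .
qed

text \<open>
  Splitting an interval where \<open>V\<close> attains the mean of its two end values halves the quadratic bound, so
  iterating makes the increment of \<open>F\<close> arbitrarily small. This replaces an argument by derivatives,
  since the primitive of an integrable function may fail to be differentiable at some points.
\<close>
lemma constant_if_quadratic_increments:
  fixes F V :: "real \<Rightarrow> real"
  assumes cont: "\<And>x. isCont V x"
    and quad: "\<And>x y. x \<le> y \<Longrightarrow> \<bar>F y - F x\<bar> \<le> C * (V y - V x)\<^sup>2"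
  shows "F x = F y"
proof -
  have half: "\<bar>F y - F x\<bar> \<le> C * (V y - V x)\<^sup>2 / 2 ^ n" if "x \<le> y" for x y n
    using that
  proof (induction n arbitrary: x y)
    case 0
    then show ?case using quad by simp
  next
    case (Suc n)
    have "\<exists>z. x \<le> z \<and> z \<le> y \<and> V z = (V x + V y) / 2"
    proof (cases "V x \<le> V y")
      case True
      then show ?thesis using Suc.prems cont
        by (intro IVT) auto
    next
      case False
      then show ?thesis using Suc.prems cont
        by (intro IVT2) auto
    qed
    then obtain z where z: "x \<le> z" "z \<le> y" "V z = (V x + V y) / 2" by auto
    have "\<bar>F y - F x\<bar> \<le> \<bar>F y - F z\<bar> + \<bar>F z - F x\<bar>" by simp
    also have "\<dots> \<le> C * (V y - V z)\<^sup>2 / 2 ^ n + C * (V z - V x)\<^sup>2 / 2 ^ n"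
      using Suc.IH z by (intro add_mono) auto
    also have "\<dots> = C * (V y - V x)\<^sup>2 / 2 ^ Suc n"
      unfolding z(3) by (simp add: field_simps power2_eq_square)
    finally show ?case .
  qed
  have eq: "F x = F y" if "x \<le> y" for x y
  proof -
    have "(\<lambda>n. C * (V y - V x)\<^sup>2 / 2 ^ n) \<longlonglongrightarrow> 0"
      by (intro LIMSEQ_divide_realpow_zero) auto
    then have "\<bar>F y - F x\<bar> \<le> 0"
      by (rule LIMSEQ_le_const) (use half[OF that] in auto)
    then show ?thesis by simp
  qed
  show ?thesis using eq[of x y] eq[of y x] by linarith
qed

lemma exp_remainder_bounds:
  fixes s :: real
  assumes "\<bar>s\<bar> \<le> R"
  shows "\<bar>exp s - 1 - s\<bar> \<le> exp R * s\<^sup>2" and "\<bar>exp s - 1\<bar> \<le> exp R * \<bar>s\<bar>"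
proof -
  have R0: "0 \<le> R" using assms by linarith
  have "\<exists>\<theta>. \<bar>\<theta>\<bar> \<le> \<bar>s\<bar> \<and> exp s = (\<Sum>m<2. s ^ m / fact m) + exp \<theta> / fact 2 * s ^ 2"
    by (rule Maclaurin_exp_le)
  then obtain \<theta> where \<theta>: "\<bar>\<theta>\<bar> \<le> \<bar>s\<bar>"
    "exp s = (\<Sum>m<2. s ^ m / fact m) + exp \<theta> / fact 2 * s ^ 2" by blast
  then have "exp s - 1 - s = exp \<theta> / 2 * s\<^sup>2" by (simp add: numeral_2_eq_2)
  moreover have "exp \<theta> / 2 \<le> exp R"
    using \<theta>(1) assms exp_le_cancel_iff[of \<theta> R] exp_gt_zero[of R] exp_gt_zero[of \<theta>] by linarith
  ultimately show "\<bar>exp s - 1 - s\<bar> \<le> exp R * s\<^sup>2"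
    by (simp only: abs_mult abs_power2) (intro mult_right_mono, auto)
  have "\<exists>\<theta>. \<bar>\<theta>\<bar> \<le> \<bar>s\<bar> \<and> exp s = (\<Sum>m<1. s ^ m / fact m) + exp \<theta> / fact 1 * s ^ 1"
    by (rule Maclaurin_exp_le)
  then obtain \<theta> where \<theta>: "\<bar>\<theta>\<bar> \<le> \<bar>s\<bar>"
    "exp s = (\<Sum>m<1. s ^ m / fact m) + exp \<theta> / fact 1 * s ^ 1" by blast
  then have "exp s - 1 = exp \<theta> * s" by simp
  moreover have "exp \<theta> \<le> exp R" using \<theta>(1) assms by simp
  ultimately show "\<bar>exp s - 1\<bar> \<le> exp R * \<bar>s\<bar>"
    by (simp add: abs_mult mult_right_mono)
qed

text \<open>
  The chain rule \<open>(exp (- \<beta> U))' = - \<beta> f exp (- \<beta> U)\<close> for the primitive \<open>U\<close> of a merely integrable \<open>f\<close>.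
  As \<open>U\<close> need not be differentiable everywhere, the proof compares \<open>E = exp (- \<beta> U)\<close> with
  \<open>- \<beta>\<close> times the primitive of \<open>E f\<close>: over an interval the two increments agree to second order in
  the mass of \<open>\<bar>f\<bar>\<close> there. Their difference is thus constant, and its limits at both ends of the line
  give the identity.
\<close>
lemma integral_exp_primitive:
  fixes f :: "real \<Rightarrow> real" and \<beta> :: real
  assumes f: "integrable lborel f"
  defines "E \<equiv> \<lambda>x. exp (- \<beta> * primitive f x)"
  shows "\<beta> * (LINT x|lborel. E x * f x) = 1 - exp (- \<beta> * (LINT x|lborel. f x))"
proof -
  define M where "M = (LINT x|lborel. \<bar>f x\<bar>)"
  define R where "R = 2 * \<bar>\<beta>\<bar> * M"
  define B where "B = exp (\<bar>\<beta>\<bar> * M)"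
  \<comment> \<open>The variation function against which second-order errors are measured.\<close>
  define V where "V = primitive (\<lambda>x. \<bar>f x\<bar>)"
  have [measurable]: "f \<in> borel_measurable borel" using f by auto
  have absf: "integrable lborel (\<lambda>x. \<bar>f x\<bar>)" using f by auto
  have contE: "isCont E x" for x
    unfolding E_def by (intro continuous_intros isCont_primitive f)
  have [measurable]: "E \<in> borel_measurable borel"
    by (intro borel_measurable_continuous_onI) (auto simp: continuous_on_eq_continuous_at contE)
  have Epos: "E x > 0" for x by (simp add: E_def)
  have EB: "E x \<le> B" for x
  proof -
    have "- \<beta> * primitive f x \<le> \<bar>\<beta>\<bar> * \<bar>primitive f x\<bar>"
      by (metis abs_ge_self abs_minus_cancel abs_mult mult_minus_left)
    also have "\<dots> \<le> \<bar>\<beta>\<bar> * M" unfolding M_def by (intro mult_left_mono primitive_bound f) auto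
    finally show ?thesis by (simp add: E_def B_def)
  qed
  have Ef: "integrable lborel (\<lambda>x. E x * f x)"
    by (rule Bochner_Integration.integrable_bound[where f="\<lambda>x. B * f x"])
      (use f EB Epos in \<open>auto simp: abs_mult less_imp_le B_def intro!: mult_right_mono\<close>)
  have V_diff: "\<bar>primitive f y - primitive f x\<bar> \<le> V y - V x" if "x \<le> y" for x y
    unfolding V_def primitive_diff[OF f that] primitive_diff[OF absf that]
    using set_integral_norm_bound[of lborel "{x<..y}" f]
      integrable_mult_indicator[of "{x<..y}" lborel f] f
    by (auto simp: set_integrable_def)
  have Ediff: "\<bar>E y - E x\<bar> \<le> B * exp R * \<bar>\<beta>\<bar> * (V y - V x)"
    and Ediff2: "\<bar>E y - E x + \<beta> * E x * (primitive f y - primitive f x)\<bar> \<le> B * exp R * \<beta>\<^sup>2 * (V y - V x)\<^sup>2"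
    if "x \<le> y" for x y
  proof -
    define s where "s = - \<beta> * (primitive f y - primitive f x)"
    have "\<bar>primitive f y - primitive f x\<bar> \<le> 2 * M"
      using primitive_bound[OF f, of x] primitive_bound[OF f, of y] unfolding M_def by linarith
    then have sR: "\<bar>s\<bar> \<le> R" unfolding s_def R_def abs_mult abs_minus_cancel
      using mult_left_mono[of "\<bar>primitive f y - primitive f x\<bar>" "2*M" "\<bar>\<beta>\<bar>"] by (simp add: mult_ac)
    have sV: "\<bar>s\<bar> \<le> \<bar>\<beta>\<bar> * (V y - V x)" unfolding s_def abs_mult abs_minus_cancel
      by (intro mult_left_mono V_diff that) auto
    have Ey: "E y = E x * exp s"
      unfolding E_def s_def by (simp add: exp_add[symmetric] algebra_simps)
    have "\<bar>E y - E x\<bar> = E x * \<bar>exp s - 1\<bar>"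
    proof -
      have "E y - E x = E x * (exp s - 1)" unfolding Ey by (simp add: algebra_simps)
      then show ?thesis using Epos[of x] by (simp add: abs_mult)
    qed
    also have "\<dots> \<le> B * (exp R * (\<bar>\<beta>\<bar> * (V y - V x)))"
      using EB Epos[of x]
      by (intro mult_mono order.trans[OF exp_remainder_bounds(2)[OF sR]] sV) (auto simp: B_def)
    finally show "\<bar>E y - E x\<bar> \<le> B * exp R * \<bar>\<beta>\<bar> * (V y - V x)" by (simp add: mult_ac)
    have "E y - E x + \<beta> * E x * (primitive f y - primitive f x) = E x * (exp s - 1 - s)"
      unfolding Ey s_def by (simp add: algebra_simps)
    then have "\<bar>E y - E x + \<beta> * E x * (primitive f y - primitive f x)\<bar> = E x * \<bar>exp s - 1 - s\<bar>"
      using Epos[of x] by (simp add: abs_mult)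
    also have "\<dots> \<le> B * (exp R * (\<bar>\<beta>\<bar> * (V y - V x))\<^sup>2)"
      using EB Epos[of x] sV
      by (intro mult_mono order.trans[OF exp_remainder_bounds(1)[OF sR]])
        (auto simp: B_def abs_le_square_iff[symmetric])
    finally show "\<bar>E y - E x + \<beta> * E x * (primitive f y - primitive f x)\<bar> \<le> B * exp R * \<beta>\<^sup>2 * (V y - V x)\<^sup>2"
      by (simp add: power_mult_distrib mult_ac)
  qed
  \<comment> \<open>Second-order increments make \<open>F\<close> constant.\<close>
  define F where "F x = E x + \<beta> * primitive (\<lambda>x. E x * f x) x" for x
  have "\<bar>F y - F x\<bar> \<le> (2 * (B * exp R * \<beta>\<^sup>2)) * (V y - V x)\<^sup>2" if xy: "x \<le> y" for x y
  proof -
    have Vmono: "V s \<le> V y" if "s \<le> y" for s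
      using V_diff[OF that] by linarith
    have i: "integrable lborel (\<lambda>\<xi>. indicator {x<..y} \<xi> *\<^sub>R g \<xi>)" if "integrable lborel g" for g :: "real \<Rightarrow> real"
      using that by (intro integrable_mult_indicator) auto
    have "(LINT \<xi>|lborel. indicator {x<..y} \<xi> *\<^sub>R ((E \<xi> - E x) * f \<xi>))
      = (LINT \<xi>|lborel. indicator {x<..y} \<xi> *\<^sub>R (E \<xi> * f \<xi>) - E x * (indicator {x<..y} \<xi> *\<^sub>R f \<xi>))"
      by (intro Bochner_Integration.integral_cong) (auto simp: algebra_simps)
    also have "\<dots> = (primitive (\<lambda>x. E x * f x) y - primitive (\<lambda>x. E x * f x) x) - E x * (primitive f y - primitive f x)"
      unfolding primitive_diff[OF f xy] primitive_diff[OF Ef xy] unfolding set_lebesgue_integral_def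
      unfolding Bochner_Integration.integral_diff[OF i[OF Ef] integrable_mult_right[OF i[OF f]]]
        integral_mult_right_zero ..
    finally have "\<bar>primitive (\<lambda>x. E x * f x) y - primitive (\<lambda>x. E x * f x) x - E x * (primitive f y - primitive f x)\<bar>
      = \<bar>LINT \<xi>|lborel. indicator {x<..y} \<xi> *\<^sub>R ((E \<xi> - E x) * f \<xi>)\<bar>" by simp
    also have "\<dots> \<le> (LINT \<xi>|lborel. B * exp R * \<bar>\<beta>\<bar> * (V y - V x) * (indicator {x<..y} \<xi> *\<^sub>R \<bar>f \<xi>\<bar>))"
    proof (rule order.trans[OF integral_abs_bound], rule integral_mono)
      have "integrable lborel (\<lambda>\<xi>. E \<xi> * f \<xi> - E x * f \<xi>)" using Ef f by auto
      then show "integrable lborel (\<lambda>\<xi>. \<bar>indicator {x<..y} \<xi> *\<^sub>R ((E \<xi> - E x) * f \<xi>)\<bar>)"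
        using i by (auto simp: left_diff_distrib)
      show "integrable lborel (\<lambda>\<xi>. B * exp R * \<bar>\<beta>\<bar> * (V y - V x) * (indicator {x<..y} \<xi> *\<^sub>R \<bar>f \<xi>\<bar>))"
        using i[OF absf] by auto
      fix \<xi>
      have "\<bar>E \<xi> - E x\<bar> \<le> B * exp R * \<bar>\<beta>\<bar> * (V y - V x)" if "x < \<xi>" "\<xi> \<le> y"
      proof -
        have "\<bar>E \<xi> - E x\<bar> \<le> B * exp R * \<bar>\<beta>\<bar> * (V \<xi> - V x)" using Ediff that by simp
        also have "\<dots> \<le> B * exp R * \<bar>\<beta>\<bar> * (V y - V x)"
          using Vmono that by (intro mult_left_mono) (auto simp: B_def)
        finally show ?thesis .
      qed
      then show "\<bar>indicator {x<..y} \<xi> *\<^sub>R ((E \<xi> - E x) * f \<xi>)\<bar>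
          \<le> B * exp R * \<bar>\<beta>\<bar> * (V y - V x) * (indicator {x<..y} \<xi> *\<^sub>R \<bar>f \<xi>\<bar>)"
        by (auto simp: indicator_def abs_mult intro!: mult_right_mono)
    qed
    also have "\<dots> = B * exp R * \<bar>\<beta>\<bar> * (V y - V x) * (V y - V x)"
      unfolding V_def primitive_diff[OF absf xy]
      unfolding set_lebesgue_integral_def by (rule integral_mult_right_zero)
    finally have P: "\<bar>primitive (\<lambda>x. E x * f x) y - primitive (\<lambda>x. E x * f x) x - E x * (primitive f y - primitive f x)\<bar>
       \<le> B * exp R * \<bar>\<beta>\<bar> * (V y - V x)\<^sup>2" (is "\<bar>?D\<bar> \<le> _") by (simp add: power2_eq_square mult_ac)
    have eq: "F y - F x = (E y - E x + \<beta> * E x * (primitive f y - primitive f x)) + \<beta> * ?D"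
      unfolding F_def by (simp add: algebra_simps)
    have "\<bar>F y - F x\<bar> \<le> \<bar>E y - E x + \<beta> * E x * (primitive f y - primitive f x)\<bar> + \<bar>\<beta>\<bar> * \<bar>?D\<bar>"
      unfolding eq abs_mult[symmetric] by (intro abs_triangle_ineq)
    also have "\<dots> \<le> B * exp R * \<beta>\<^sup>2 * (V y - V x)\<^sup>2 + \<bar>\<beta>\<bar> * (B * exp R * \<bar>\<beta>\<bar> * (V y - V x)\<^sup>2)"
      by (intro add_mono Ediff2 xy mult_left_mono P) auto
    also have "\<dots> = (2 * (B * exp R * \<beta>\<^sup>2)) * (V y - V x)\<^sup>2"
      by (simp add: power2_eq_square)
    finally show ?thesis .
  qed
  note quad = this
  have "isCont V x" for x unfolding V_def by (rule isCont_primitive[OF absf])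
  then have const: "F x = F y" for x y
    using quad by (rule constant_if_quadratic_increments)
  have "(F \<longlongrightarrow> exp (- \<beta> * 0) + \<beta> * 0) at_bot"
    unfolding F_def E_def
    by (rule tendsto_add[OF tendsto_exp[OF tendsto_mult[OF tendsto_const primitive_at_bot[OF f]]]
          tendsto_mult[OF tendsto_const primitive_at_bot[OF Ef[unfolded E_def]]]])
  then have bot: "(F \<longlongrightarrow> 1) at_bot" by simp
  have top: "(F \<longlongrightarrow> exp (- \<beta> * (LINT x|lborel. f x)) + \<beta> * (LINT x|lborel. E x * f x)) at_top"
    unfolding F_def E_def
    by (rule tendsto_add[OF tendsto_exp[OF tendsto_mult[OF tendsto_const primitive_at_top[OF f]]]
          tendsto_mult[OF tendsto_const primitive_at_top[OF Ef[unfolded E_def]]]])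
  have F0: "(F \<longlongrightarrow> F 0) A" for A
    by (rule tendsto_eventually) (intro always_eventually allI const)
  have "F 0 = 1"
    by (rule tendsto_unique[OF trivial_limit_at_bot_linorder F0 bot])
  moreover have "F 0 = exp (- \<beta> * (LINT x|lborel. f x)) + \<beta> * (LINT x|lborel. E x * f x)"
    by (rule tendsto_unique[OF trivial_limit_at_top_linorder F0 top])
  ultimately show ?thesis by linarith
qed

section \<open>The Gaussian kernel\<close>

text \<open>
  The heat kernel of diffusivity \<open>c\<close> at time \<open>1\<close> up to its normalising factor, which cancels in the
  Cole--Hopf quotient.
\<close>
definition gauss :: "real \<Rightarrow> real \<Rightarrow> real" where
  "gauss c x = exp (- (x\<^sup>2 / (4 * c)))"

lemma gauss_pos [simp]: "0 < gauss c x" "0 \<le> gauss c x" "gauss c x \<noteq> 0"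
  by (simp_all add: gauss_def)

lemma gauss_minus [simp]: "gauss c (- x) = gauss c x"
  by (simp add: gauss_def)

lemma gauss_le_1: "c > 0 \<Longrightarrow> gauss c x \<le> 1"
  by (simp add: gauss_def)

lemma borel_measurable_gauss [measurable]: "gauss c \<in> borel_measurable borel"
  unfolding gauss_def by measurable

lemma isCont_gauss: "isCont (gauss c) x"
  unfolding gauss_def by (cases "c = 0") (auto intro!: continuous_intros)

lemma gauss_eq_normal_density:
  assumes "c > 0"
  shows "gauss c = (\<lambda>x. sqrt (4 * pi * c) * normal_density 0 (sqrt (2 * c)) x)"
proof
  fix x
  have *: "2 * pi * (sqrt (2 * c))\<^sup>2 = 4 * pi * c" "2 * (sqrt (2 * c))\<^sup>2 = 4 * c"
    using assms by auto
  have "sqrt (4 * pi * c) \<noteq> 0" using assms by simp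
  then have "sqrt (4 * pi * c) * (1 / sqrt (4 * pi * c)) = 1" by (metis divide_self times_divide_eq_right mult_1_right)
  then show "gauss c x = sqrt (4 * pi * c) * normal_density 0 (sqrt (2 * c)) x"
    unfolding gauss_def normal_density_def * by (simp only: mult.assoc[symmetric]) (simp only: mult_1_left diff_zero minus_divide_left)
qed

lemma integrable_gauss: "c > 0 \<Longrightarrow> integrable lborel (gauss c)"
  by (simp add: gauss_eq_normal_density)

lemma integrable_gauss_diff:
  assumes "c > 0"
  shows "integrable lborel (\<lambda>y. gauss c (x - y))"
  using lborel_integrable_real_affine[OF integrable_gauss[OF assms], of "-1" x] by simp

lemma integrable_gauss_diff':
  assumes "c > 0"
  shows "integrable lborel (\<lambda>x. gauss c (x - y))"
  using lborel_integrable_real_affine[OF integrable_gauss[OF assms], of "1" "-y"] by simp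

lemma integral_gauss_diff: "(LINT y|lborel. gauss c (x - y)) = (LINT y|lborel. gauss c y)"
  using lborel_integral_real_affine[of "-1" "gauss c" x] by simp

lemma integral_gauss_diff': "(LINT x|lborel. gauss c (x - y)) = (LINT x|lborel. gauss c x)"
  using lborel_integral_real_affine[of "1" "gauss c" "-y"] by simp

lemma integral_gauss_pos: "c > 0 \<Longrightarrow> 0 < (LINT x|lborel. gauss c x)"
  by (simp add: gauss_eq_normal_density)

lemma gauss_lipschitz:
  assumes "c > 0"
  shows "\<bar>gauss c x - gauss c y\<bar> \<le> 1 / sqrt c * \<bar>x - y\<bar>"
proof -
  have "norm (gauss c x - gauss c y) \<le> 1 / sqrt c * norm (x - y)"
  proof (rule field_differentiable_bound[where S=UNIV])
    fix z :: real
    show "(gauss c has_field_derivative (- (z / (2 * c)) * gauss c z)) (at z within UNIV)"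
      unfolding gauss_def using assms
      by (auto intro!: derivative_eq_intros simp: field_simps)
    define q where "q = \<bar>z\<bar> / sqrt c"
    have qq: "z\<^sup>2 / (4 * c) = q\<^sup>2 / 4" using assms by (simp add: q_def power_divide)
    have "1 + z\<^sup>2 / (4 * c) \<le> exp (z\<^sup>2 / (4 * c))" by (rule exp_ge_add_one_self)
    \<comment> \<open>The square of \<open>q/2 - 1/2\<close> is nonnegative; together with \<open>1 + s \<le> exp s\<close> this bounds the derivative.\<close>
    moreover have "q / 2 \<le> 1 + q\<^sup>2 / 4"
      using zero_le_power2[of "q/2 - 1/2"] by (simp add: power2_eq_square algebra_simps)
    ultimately have "q / 2 * gauss c z \<le> 1"
      unfolding gauss_def qq by (simp add: exp_minus field_simps)
    moreover have "\<bar>- (z / (2 * c)) * gauss c z\<bar> = q / 2 * gauss c z / sqrt c"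
      using assms by (simp add: q_def abs_mult real_div_sqrt field_simps)
    ultimately show "norm (- (z / (2 * c)) * gauss c z) \<le> 1 / sqrt c"
      using divide_right_mono[of "q / 2 * gauss c z" 1 "sqrt c"] assms by simp
  qed auto
  then show ?thesis by simp
qed

text \<open>
  An integrable majorant common to all small translates of the kernel; the price is a doubled \<open>c\<close>.
\<close>
lemma gauss_shift_le:
  assumes "c > 0" "\<bar>h\<bar> \<le> 1"
  shows "gauss c (x - h) \<le> exp (1 / (4 * c)) * gauss (2 * c) x"
proof -
  have "x\<^sup>2 / 2 \<le> (x - h)\<^sup>2 + h\<^sup>2"
    using zero_le_power2[of "x - 2 * h"] by (simp add: power2_eq_square algebra_simps)
  moreover have "h\<^sup>2 \<le> 1" using assms(2) by (simp add: abs_square_le_1)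
  ultimately have "- (x - h)\<^sup>2 \<le> 1 - x\<^sup>2 / 2" by linarith
  then have "- (x - h)\<^sup>2 / (4 * c) \<le> (1 - x\<^sup>2 / 2) / (4 * c)"
    using assms(1) by (intro divide_right_mono) auto
  then show ?thesis unfolding gauss_def
    by (simp add: exp_add[symmetric] diff_divide_distrib flip: exp_add)
qed

lemma const_divide_tendsto_0: "((\<lambda>r. y / r) \<longlongrightarrow> (0::real)) at_top"
  by (intro tendsto_divide_0[OF tendsto_const] filterlim_at_top_imp_at_infinity filterlim_ident)

text \<open>
  On the diffusive length scale an integrable density shrinks to a point mass: the average is
  \<open>\<integral> gauss (\<xi> - y / r) v y dy\<close>, and the Lipschitz bound of the kernel controls the displacement \<open>y / r\<close>
  uniformly in \<open>\<xi>\<close>. Dominated convergence handles the large \<open>y\<close>, for which the displacement is not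
  small.
\<close>
lemma gauss_average_uniform:
  fixes v :: "real \<Rightarrow> real"
  assumes c: "c > 0" and v: "integrable lborel v"
  shows "\<exists>s. (s \<longlongrightarrow> 0) at_top \<and>
    (\<forall>r \<xi>. \<bar>(LINT y|lborel. gauss c (\<xi> - y / r) * v y) - (LINT y|lborel. v y) * gauss c \<xi>\<bar> \<le> s r)"
proof -
  have [measurable]: "v \<in> borel_measurable borel" using v by auto
  \<comment> \<open>A bound for the kernel displacement that is uniform in the centre.\<close>
  define k where "k r y = min 1 (1 / sqrt c * \<bar>y / r\<bar>)" for r y
  have [measurable]: "k r \<in> borel_measurable borel" for r unfolding k_def by measurable
  define s where "s r = (LINT y|lborel. k r y * \<bar>v y\<bar>)" for r
  have k01: "0 \<le> k r y" "k r y \<le> 1" for r y using c by (auto simp: k_def)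
  have kv: "integrable lborel (\<lambda>y. k r y * \<bar>v y\<bar>)" for r
    by (rule Bochner_Integration.integrable_bound[OF v]) (use k01 in \<open>auto simp: abs_mult mult_left_le_one_le\<close>)
  have gv: "integrable lborel (\<lambda>y. gauss c (\<xi> - y / r) * v y)" for r \<xi>
    by (rule Bochner_Integration.integrable_bound[OF v])
      (use gauss_le_1[OF c] in \<open>auto simp: abs_mult mult_left_le_one_le\<close>)
  have "(s \<longlongrightarrow> integral\<^sup>L lborel (\<lambda>y::real. 0::real)) at_top"
    unfolding s_def
  proof (rule integral_dominated_convergence_at_top[where w="\<lambda>y. \<bar>v y\<bar>"])
    show "AE y in lborel. ((\<lambda>r. k r y * \<bar>v y\<bar>) \<longlongrightarrow> 0) at_top"
    proof (rule AE_I2)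
      fix y
      have "((\<lambda>r. min 1 (1 / sqrt c * \<bar>y / r\<bar>) * \<bar>v y\<bar>) \<longlongrightarrow> min 1 (1 / sqrt c * \<bar>0\<bar>) * \<bar>v y\<bar>) at_top"
        by (intro tendsto_intros const_divide_tendsto_0)
      then show "((\<lambda>r. k r y * \<bar>v y\<bar>) \<longlongrightarrow> 0) at_top" by (simp add: k_def)
    qed
    show "\<forall>\<^sub>F r in at_top. AE y in lborel. norm (k r y * \<bar>v y\<bar>) \<le> \<bar>v y\<bar>"
      using k01 by (intro always_eventually allI AE_I2) (auto simp: abs_mult mult_left_le_one_le)
  qed (use v in auto)
  then have "(s \<longlongrightarrow> 0) at_top" by simp
  moreover have "\<bar>(LINT y|lborel. gauss c (\<xi> - y / r) * v y) - (LINT y|lborel. v y) * gauss c \<xi>\<bar> \<le> s r" for r \<xi>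
  proof -
    have "(LINT y|lborel. gauss c (\<xi> - y / r) * v y) - (LINT y|lborel. v y) * gauss c \<xi>
      = (LINT y|lborel. gauss c (\<xi> - y / r) * v y - gauss c \<xi> * v y)"
      using v gv by (subst Bochner_Integration.integral_diff) (auto simp: mult.commute)
    also have "\<bar>\<dots>\<bar> \<le> (LINT y|lborel. \<bar>gauss c (\<xi> - y / r) * v y - gauss c \<xi> * v y\<bar>)"
      by (rule integral_abs_bound)
    also have "\<dots> \<le> s r"
      unfolding s_def
    proof (rule integral_mono)
      fix y
      have "\<bar>gauss c (\<xi> - y / r) - gauss c \<xi>\<bar> \<le> 1 / sqrt c * \<bar>y / r\<bar>"
        using gauss_lipschitz[OF c, of "\<xi> - y / r" \<xi>] by simp
      moreover have "\<bar>gauss c (\<xi> - y / r) - gauss c \<xi>\<bar> \<le> 1"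
        using gauss_le_1[OF c, of \<xi>] gauss_le_1[OF c, of "\<xi> - y / r"]
          gauss_pos(2)[of c \<xi>] gauss_pos(2)[of c "\<xi> - y / r"] by linarith
      ultimately have "\<bar>gauss c (\<xi> - y / r) - gauss c \<xi>\<bar> \<le> k r y" by (simp add: k_def)
      then show "\<bar>gauss c (\<xi> - y / r) * v y - gauss c \<xi> * v y\<bar> \<le> k r y * \<bar>v y\<bar>"
        by (simp add: abs_mult mult_right_mono flip: left_diff_distrib)
    qed (use v gv kv in auto)
    finally show ?thesis .
  qed
  ultimately show ?thesis by blast
qed

text \<open>
  The same concentration in the mean: by Tonelli the \<open>L\<^sup>1\<close> error is at most the average over \<open>\<bar>v\<bar>\<close> of
  the \<open>L\<^sup>1\<close> modulus of continuity of the kernel at \<open>y / r\<close>.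
\<close>
lemma gauss_average_L1:
  fixes v :: "real \<Rightarrow> real"
  assumes c: "c > 0" and v: "integrable lborel v"
  shows "((\<lambda>r. \<integral>\<^sup>+ \<xi>. ennreal \<bar>(LINT y|lborel. gauss c (\<xi> - y / r) * v y) - (LINT y|lborel. v y) * gauss c \<xi>\<bar> \<partial>lborel)
    \<longlongrightarrow> 0) at_top"
proof -
  have [measurable]: "v \<in> borel_measurable borel" using v by auto
  \<comment> \<open>The translation modulus of the kernel in the mean.\<close>
  define \<omega> where "\<omega> h = (LINT \<xi>|lborel. \<bar>gauss c (\<xi> - h) - gauss c \<xi>\<bar>)" for h
  have gi: "integrable lborel (\<lambda>\<xi>. \<bar>gauss c (\<xi> - h) - gauss c \<xi>\<bar>)" for h
    using integrable_gauss[OF c] integrable_gauss_diff'[OF c] by auto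
  have [measurable]: "\<omega> \<in> borel_measurable borel" unfolding \<omega>_def by measurable
  have \<omega>0: "0 \<le> \<omega> h" for h unfolding \<omega>_def by (rule integral_nonneg_AE) auto
  have \<omega>2: "\<omega> h \<le> 2 * (LINT \<xi>|lborel. gauss c \<xi>)" for h
  proof -
    have "\<omega> h \<le> (LINT \<xi>|lborel. gauss c (\<xi> - h) + gauss c \<xi>)"
      unfolding \<omega>_def
    proof (rule integral_mono)
      show "\<bar>gauss c (\<xi> - h) - gauss c \<xi>\<bar> \<le> gauss c (\<xi> - h) + gauss c \<xi>" for \<xi>
        using gauss_pos(2)[of c \<xi>] gauss_pos(2)[of c "\<xi> - h"] by linarith
    qed (use gi integrable_gauss[OF c] integrable_gauss_diff'[OF c] in auto)
    also have "\<dots> = 2 * (LINT \<xi>|lborel. gauss c \<xi>)"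
      using integrable_gauss[OF c] integrable_gauss_diff'[OF c] by (simp add: integral_gauss_diff')
    finally show ?thesis .
  qed
  have \<omega>_lim: "((\<lambda>r. \<omega> (y / r)) \<longlongrightarrow> 0) at_top" for y
  proof -
    have "((\<lambda>r. \<omega> (y / r)) \<longlongrightarrow> integral\<^sup>L lborel (\<lambda>y::real. 0::real)) at_top"
      unfolding \<omega>_def
    proof (rule integral_dominated_convergence_at_top[where w="\<lambda>\<xi>. exp (1 / (4 * c)) * gauss (2 * c) \<xi> + gauss c \<xi>"])
      show "integrable lborel (\<lambda>\<xi>. exp (1 / (4 * c)) * gauss (2 * c) \<xi> + gauss c \<xi>)"
        using c integrable_gauss[of c] integrable_gauss[of "2 * c"] by auto
      show "AE \<xi> in lborel. ((\<lambda>r. \<bar>gauss c (\<xi> - y / r) - gauss c \<xi>\<bar>) \<longlongrightarrow> 0) at_top"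
      proof (rule AE_I2)
        fix \<xi>
        have "((\<lambda>r. \<xi> - y / r) \<longlongrightarrow> \<xi> - 0) at_top" by (intro tendsto_intros const_divide_tendsto_0)
        then have "((\<lambda>r. gauss c (\<xi> - y / r)) \<longlongrightarrow> gauss c \<xi>) at_top"
          using isCont_tendsto_compose[OF isCont_gauss[of \<xi> c]] by simp
        then have "((\<lambda>r. \<bar>gauss c (\<xi> - y / r) - gauss c \<xi>\<bar>) \<longlongrightarrow> \<bar>gauss c \<xi> - gauss c \<xi>\<bar>) at_top"
          by (intro tendsto_intros)
        then show "((\<lambda>r. \<bar>gauss c (\<xi> - y / r) - gauss c \<xi>\<bar>) \<longlongrightarrow> 0) at_top" by simp
      qed
      have "((\<lambda>r. \<bar>y / r\<bar>) \<longlongrightarrow> \<bar>0\<bar>) at_top" by (intro tendsto_rabs const_divide_tendsto_0)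
      then have "eventually (\<lambda>r. \<bar>y / r\<bar> < 1) at_top" by (rule order_tendstoD) simp
      then show "\<forall>\<^sub>F r in at_top. AE \<xi> in lborel. norm \<bar>gauss c (\<xi> - y / r) - gauss c \<xi>\<bar>
          \<le> exp (1 / (4 * c)) * gauss (2 * c) \<xi> + gauss c \<xi>"
      proof eventually_elim
        case (elim r)
        show ?case
        proof (rule AE_I2)
          fix \<xi>
          have "gauss c (\<xi> - y / r) \<le> exp (1 / (4 * c)) * gauss (2 * c) \<xi>"
            using elim by (intro gauss_shift_le[OF c]) simp
          then show "norm \<bar>gauss c (\<xi> - y / r) - gauss c \<xi>\<bar> \<le> exp (1 / (4 * c)) * gauss (2 * c) \<xi> + gauss c \<xi>"
            using gauss_pos(2)[of c \<xi>] gauss_pos(2)[of c "\<xi> - y / r"]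
            unfolding real_norm_def by linarith
        qed
      qed
    qed (auto)
    then show ?thesis by simp
  qed
  have \<omega>v: "integrable lborel (\<lambda>y. \<bar>v y\<bar> * \<omega> (y / r))" for r
    by (rule Bochner_Integration.integrable_bound[where f="\<lambda>y. \<bar>v y\<bar> * (2 * (LINT \<xi>|lborel. gauss c \<xi>))"])
      (use v \<omega>0 \<omega>2 integral_gauss_pos[OF c] in \<open>auto simp: abs_mult intro!: mult_left_mono\<close>)
  have "((\<lambda>r. LINT y|lborel. \<bar>v y\<bar> * \<omega> (y / r)) \<longlongrightarrow> integral\<^sup>L lborel (\<lambda>y::real. 0::real)) at_top"
  proof (rule integral_dominated_convergence_at_top[where w="\<lambda>y. \<bar>v y\<bar> * (2 * (LINT \<xi>|lborel. gauss c \<xi>))"])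
    show "AE y in lborel. ((\<lambda>r. \<bar>v y\<bar> * \<omega> (y / r)) \<longlongrightarrow> 0) at_top"
      by (intro AE_I2 tendsto_mult_right_zero \<omega>_lim)
    show "\<forall>\<^sub>F r in at_top. AE y in lborel. norm (\<bar>v y\<bar> * \<omega> (y / r)) \<le> \<bar>v y\<bar> * (2 * (LINT \<xi>|lborel. gauss c \<xi>))"
      using \<omega>0 \<omega>2 by (intro always_eventually allI AE_I2) (auto simp: abs_mult intro!: mult_left_mono)
  qed (use v in auto)
  then have lim: "((\<lambda>r. ennreal (LINT y|lborel. \<bar>v y\<bar> * \<omega> (y / r))) \<longlongrightarrow> 0) at_top"
    using tendsto_ennrealI by fastforce
  have bound: "(\<integral>\<^sup>+ \<xi>. ennreal \<bar>(LINT y|lborel. gauss c (\<xi> - y / r) * v y) - (LINT y|lborel. v y) * gauss c \<xi>\<bar> \<partial>lborel)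
     \<le> ennreal (LINT y|lborel. \<bar>v y\<bar> * \<omega> (y / r))" for r
  proof -
    have gv: "integrable lborel (\<lambda>y. gauss c (\<xi> - y / r) * v y)" for \<xi>
      by (rule Bochner_Integration.integrable_bound[OF v])
        (use gauss_le_1[OF c] in \<open>auto simp: abs_mult mult_left_le_one_le\<close>)
    have "(\<integral>\<^sup>+ \<xi>. ennreal \<bar>(LINT y|lborel. gauss c (\<xi> - y / r) * v y) - (LINT y|lborel. v y) * gauss c \<xi>\<bar> \<partial>lborel)
      = (\<integral>\<^sup>+ \<xi>. ennreal (norm (LINT y|lborel. (gauss c (\<xi> - y / r) - gauss c \<xi>) * v y)) \<partial>lborel)"
    proof (intro nn_integral_cong)
      fix \<xi>
      have "(LINT y|lborel. (gauss c (\<xi> - y / r) - gauss c \<xi>) * v y)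
        = (LINT y|lborel. gauss c (\<xi> - y / r) * v y) - (LINT y|lborel. v y) * gauss c \<xi>"
        unfolding left_diff_distrib using v gv
        by (subst Bochner_Integration.integral_diff) (auto simp: mult.commute)
      then show "ennreal \<bar>(LINT y|lborel. gauss c (\<xi> - y / r) * v y) - (LINT y|lborel. v y) * gauss c \<xi>\<bar>
        = ennreal (norm (LINT y|lborel. (gauss c (\<xi> - y / r) - gauss c \<xi>) * v y))" by simp
    qed
    also have "\<dots> \<le> (\<integral>\<^sup>+ \<xi>. (\<integral>\<^sup>+ y. ennreal (norm ((gauss c (\<xi> - y / r) - gauss c \<xi>) * v y)) \<partial>lborel) \<partial>lborel)"
      using v gv by (intro nn_integral_mono integral_norm_bound_ennreal) (auto simp: left_diff_distrib)
    also have "\<dots> = (\<integral>\<^sup>+ y. (\<integral>\<^sup>+ \<xi>. ennreal (norm ((gauss c (\<xi> - y / r) - gauss c \<xi>) * v y)) \<partial>lborel) \<partial>lborel)"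
      by (intro lborel_pair.Fubini') measurable
    also have "\<dots> = (\<integral>\<^sup>+ y. ennreal (\<bar>v y\<bar> * \<omega> (y / r)) \<partial>lborel)"
    proof (intro nn_integral_cong)
      fix y
      have "(\<integral>\<^sup>+ \<xi>. ennreal (norm ((gauss c (\<xi> - y / r) - gauss c \<xi>) * v y)) \<partial>lborel)
        = ennreal (LINT \<xi>|lborel. norm ((gauss c (\<xi> - y / r) - gauss c \<xi>) * v y))"
        using gi[of "y / r"] by (intro nn_integral_eq_integral) (auto simp: abs_mult)
      then show "(\<integral>\<^sup>+ \<xi>. ennreal (norm ((gauss c (\<xi> - y / r) - gauss c \<xi>) * v y)) \<partial>lborel) = ennreal (\<bar>v y\<bar> * \<omega> (y / r))"
        by (simp add: abs_mult \<omega>_def mult.commute)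
    qed
    also have "\<dots> = ennreal (LINT y|lborel. \<bar>v y\<bar> * \<omega> (y / r))"
      using \<omega>v \<omega>0 by (intro nn_integral_eq_integral) auto
    finally show ?thesis .
  qed
  show ?thesis
    by (rule tendsto_sandwich[OF _ _ tendsto_const lim]) (use bound in auto)
qed

text \<open>
  A bounded function that vanishes at infinity is small outside a fixed interval, which dilation by
  \<open>r\<close> contracts to length \<open>O(1/r)\<close>. It serves to replace the dilated \<open>\<phi>\<^sub>0 (z r)\<close>
  by the step function of its limits at \<open>\<plusminus>\<infinity>\<close>.
\<close>
lemma gauss_smoothing_uniform:
  fixes f :: "real \<Rightarrow> real"
  assumes c: "c > 0" and [measurable]: "f \<in> borel_measurable borel" and B: "\<And>x. \<bar>f x\<bar> \<le> B"
    and top: "(f \<longlongrightarrow> 0) at_top" and bot: "(f \<longlongrightarrow> 0) at_bot"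
    and e: "e > 0"
  shows "\<forall>\<^sub>F r in at_top. \<forall>\<xi>. \<bar>LINT z|lborel. gauss c (\<xi> - z) * f (z * r)\<bar> \<le> e"
proof -
  define I where "I = (LINT x|lborel. gauss c x)"
  have I: "I > 0" unfolding I_def by (rule integral_gauss_pos[OF c])
  define d where "d = e / (2 * I)"
  have d: "d > 0" using e I by (simp add: d_def)
  have B0: "0 \<le> B" using B[of 0] by linarith
  have "eventually (\<lambda>x. \<bar>f x\<bar> < d) at_top" "eventually (\<lambda>x. \<bar>f x\<bar> < d) at_bot"
    using order_tendstoD(2)[OF tendsto_rabs[OF top], of d] order_tendstoD(2)[OF tendsto_rabs[OF bot], of d] d by auto
  then obtain R1 R2 where R: "\<And>x. x \<ge> R1 \<Longrightarrow> \<bar>f x\<bar> < d" "\<And>x. x \<le> R2 \<Longrightarrow> \<bar>f x\<bar> < d"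
    unfolding eventually_at_top_linorder eventually_at_bot_linorder by blast
  define R where "R = max \<bar>R1\<bar> \<bar>R2\<bar>"
  have fR: "\<bar>f x\<bar> \<le> d + B * indicator {-R..R} x" for x
  proof (cases "x \<in> {-R..R}")
    case True
    then show ?thesis using B[of x] d by simp
  next
    case False
    then have "x \<ge> R1 \<or> x \<le> R2" unfolding R_def by auto
    then show ?thesis using R[of x] False by (auto intro: less_imp_le)
  qed
  have R0: "0 \<le> R" by (simp add: R_def)
  have "((\<lambda>r. (2 * B * R) / r) \<longlongrightarrow> 0) at_top" by (rule const_divide_tendsto_0)
  then have "eventually (\<lambda>r. (2 * B * R) / r < e / 2) at_top" using e by (intro order_tendstoD) auto
  then show ?thesis using eventually_gt_at_top[of 0]
  proof eventually_elim
    case (elim r)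
    show ?case
    proof
      fix \<xi>
      have gi: "integrable lborel (\<lambda>z. gauss c (\<xi> - z))" by (rule integrable_gauss_diff[OF c])
      have "\<bar>LINT z|lborel. gauss c (\<xi> - z) * f (z * r)\<bar> \<le> (LINT z|lborel. \<bar>gauss c (\<xi> - z) * f (z * r)\<bar>)"
        by (rule integral_abs_bound)
      also have "\<dots> \<le> (LINT z|lborel. d * gauss c (\<xi> - z) + B * indicator {-R/r..R/r} z)"
      proof (rule integral_mono)
        show "integrable lborel (\<lambda>z. \<bar>gauss c (\<xi> - z) * f (z * r)\<bar>)"
          by (rule Bochner_Integration.integrable_bound[where f="\<lambda>z. B * gauss c (\<xi> - z)"])
            (use gi B B0 in \<open>auto simp: abs_mult mult.commute intro!: mult_left_mono\<close>)
        show "integrable lborel (\<lambda>z. d * gauss c (\<xi> - z) + B * indicator {-R/r..R/r} z)"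
          using gi by (intro Bochner_Integration.integrable_add integrable_mult_right integrable_real_indicator)
            (auto simp: emeasure_lborel_Icc_eq)
        fix z
        have ind: "indicator {-R..R} (z * r) = (indicator {-R/r..R/r} z :: real)"
          using elim by (auto simp: indicator_def field_simps)
        have "\<bar>gauss c (\<xi> - z) * f (z * r)\<bar> \<le> gauss c (\<xi> - z) * (d + B * indicator {-R/r..R/r} z)"
          using fR[of "z * r"] unfolding ind by (simp add: abs_mult)
        also have "\<dots> \<le> d * gauss c (\<xi> - z) + B * indicator {-R/r..R/r} z"
          using gauss_le_1[OF c, of "\<xi> - z"] B0
          by (auto simp: algebra_simps indicator_def mult_left_le_one_le mult_left_le)
        finally show "\<bar>gauss c (\<xi> - z) * f (z * r)\<bar> \<le> d * gauss c (\<xi> - z) + B * indicator {-R/r..R/r} z" .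
      qed
      also have "\<dots> = d * I + 2 * B * R / r"
        using gi elim R0 by (simp add: integral_gauss_diff I_def)
      also have "\<dots> \<le> e"
        using elim I by (simp add: d_def)
      finally show "\<bar>LINT z|lborel. gauss c (\<xi> - z) * f (z * r)\<bar> \<le> e" .
    qed
  qed
qed

section \<open>Diffusion waves and the rescaled solution\<close>

text \<open>
  The value of \<open>\<integral> \<phi>\<^sub>0 u\<^sub>0\<close>, which depends on the initial state through its mass \<open>m\<close> only.
\<close>
definition wave_mass :: "real \<Rightarrow> real \<Rightarrow> real \<Rightarrow> real" where
  "wave_mass b c m = (if b = 0 then m else 2 * c / b * (1 - exp (- (b / (2 * c)) * m)))"

text \<open>
  The integral of the step function that equals \<open>1\<close> on the left half line and
  \<open>exp (- b m / (2 c))\<close> on the right one against the Gaussian centred at \<open>\<xi>\<close>, in a closed form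
  from which continuity and the limits at \<open>\<plusminus>\<infinity>\<close> can be read off.
\<close>
definition wave_denom :: "real \<Rightarrow> real \<Rightarrow> real \<Rightarrow> real \<Rightarrow> real" where
  "wave_denom b c m \<xi> = (LINT x|lborel. gauss c x) + (exp (- (b / (2 * c)) * m) - 1) * primitive (gauss c) \<xi>"

text \<open>
  The profile of the self-similar solution of Burgers' equation with initial state \<open>m\<close> times the Dirac
  mass: \<open>t powr (-1/2) * diffusion_wave b c m ((x - a t) / sqrt t)\<close> is that solution.
\<close>
definition diffusion_wave :: "real \<Rightarrow> real \<Rightarrow> real \<Rightarrow> real \<Rightarrow> real" where
  "diffusion_wave b c m \<xi> = wave_mass b c m * gauss c \<xi> / wave_denom b c m \<xi>"

text \<open>
  The Cole--Hopf solution at time \<open>r\<^sup>2\<close>, multiplied by \<open>r\<close>, in the coordinate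
  \<open>\<xi> = (x - a r\<^sup>2) / r\<close> that moves with speed \<open>a\<close>. The common factor of numerator and denominator
  cancels, and in the denominator \<open>y = z r\<close> is substituted, so that both have a limit as \<open>r \<rightarrow> \<infinity>\<close>.
\<close>
definition rescaled_solution :: "real \<Rightarrow> real \<Rightarrow> (real \<Rightarrow> real) \<Rightarrow> real \<Rightarrow> real \<Rightarrow> real" where
  "rescaled_solution b c u0 r \<xi> =
     (LINT y|lborel. gauss c (\<xi> - y / r) * (cole_hopf_init b c u0 y * u0 y)) /
     (LINT z|lborel. gauss c (\<xi> - z) * cole_hopf_init b c u0 (z * r))"

lemma cole_hopf_rescaled:
  assumes c: "c > 0" and r: "r > 0" and x: "x = a * r\<^sup>2 + \<xi> * r"
  shows "r * cole_hopf a b c u0 x (r\<^sup>2) = rescaled_solution b c u0 r \<xi>"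
proof -
  have e: "exp (- ((x - y - a * r\<^sup>2)\<^sup>2 / (4 * c * r\<^sup>2))) = gauss c (\<xi> - y / r)" for y
  proof -
    have "x - y - a * r\<^sup>2 = r * (\<xi> - y / r)" using r x by (simp add: field_simps)
    then have "(x - y - a * r\<^sup>2)\<^sup>2 / (4 * c * r\<^sup>2) = (\<xi> - y / r)\<^sup>2 / (4 * c)"
      using r by (simp add: power_mult_distrib)
    then show ?thesis by (simp add: gauss_def)
  qed
  have "(LINT y|lborel. gauss c (\<xi> - y / r) * cole_hopf_init b c u0 y)
      = r * (LINT z|lborel. gauss c (\<xi> - z) * cole_hopf_init b c u0 (z * r))"
    using r by (subst lborel_integral_real_affine[where c=r and t=0]) (auto simp: mult.commute)
  moreover have "sqrt (4 * pi * c * r\<^sup>2) \<noteq> 0" using c r by simp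
  ultimately show ?thesis using r
    unfolding cole_hopf_def cole_hopf_phi_def rescaled_solution_def e
    by (simp add: mult.assoc del: real_sqrt_eq_zero_cancel_iff)
qed

lemma cole_hopf_init_bounds:
  assumes "integrable lborel u0"
  shows "exp (- (\<bar>b / (2 * c)\<bar> * (LINT x|lborel. \<bar>u0 x\<bar>))) \<le> cole_hopf_init b c u0 x"
    and "cole_hopf_init b c u0 x \<le> exp (\<bar>b / (2 * c)\<bar> * (LINT x|lborel. \<bar>u0 x\<bar>))"
proof -
  have "\<bar>- (b / (2 * c)) * primitive u0 x\<bar> \<le> \<bar>b / (2 * c)\<bar> * (LINT x|lborel. \<bar>u0 x\<bar>)"
    unfolding abs_mult abs_minus_cancel by (intro mult_left_mono primitive_bound assms) auto
  then show "exp (- (\<bar>b / (2 * c)\<bar> * (LINT x|lborel. \<bar>u0 x\<bar>))) \<le> cole_hopf_init b c u0 x"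
    "cole_hopf_init b c u0 x \<le> exp (\<bar>b / (2 * c)\<bar> * (LINT x|lborel. \<bar>u0 x\<bar>))"
    unfolding cole_hopf_init_def exp_le_cancel_iff by linarith+
qed

lemma cole_hopf_init_pos: "cole_hopf_init b c u0 x > 0"
  by (simp add: cole_hopf_init_def)

lemma borel_measurable_cole_hopf_init:
  assumes "integrable lborel u0"
  shows "cole_hopf_init b c u0 \<in> borel_measurable borel"
proof (intro borel_measurable_continuous_onI)
  show "continuous_on UNIV (cole_hopf_init b c u0)"
    unfolding cole_hopf_init_def continuous_on_eq_continuous_at[OF open_UNIV]
    by (intro ballI continuous_intros isCont_primitive assms)
qed

lemma cole_hopf_init_at_bot:
  assumes "integrable lborel u0"
  shows "(cole_hopf_init b c u0 \<longlongrightarrow> 1) at_bot"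
  unfolding cole_hopf_init_def
  using tendsto_exp[OF tendsto_mult[OF tendsto_const[of "- (b / (2 * c))"] primitive_at_bot[OF assms]]] by simp

lemma cole_hopf_init_at_top:
  assumes "integrable lborel u0"
  shows "(cole_hopf_init b c u0 \<longlongrightarrow> exp (- (b / (2 * c)) * (LINT x|lborel. u0 x))) at_top"
  unfolding cole_hopf_init_def
  by (rule tendsto_exp[OF tendsto_mult[OF tendsto_const primitive_at_top[OF assms]]])

lemma integrable_cole_hopf_init_mult:
  assumes u0: "integrable lborel u0"
  shows "integrable lborel (\<lambda>x. cole_hopf_init b c u0 x * u0 x)"
proof (rule Bochner_Integration.integrable_bound[where f="\<lambda>x. exp (\<bar>b / (2 * c)\<bar> * (LINT x|lborel. \<bar>u0 x\<bar>)) * u0 x"])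
  have [measurable]: "u0 \<in> borel_measurable borel" using u0 by auto
  note borel_measurable_cole_hopf_init[OF u0, measurable]
  show "(\<lambda>x. cole_hopf_init b c u0 x * u0 x) \<in> borel_measurable lborel" by measurable
  show "AE x in lborel. norm (cole_hopf_init b c u0 x * u0 x)
      \<le> norm (exp (\<bar>b / (2 * c)\<bar> * (LINT x|lborel. \<bar>u0 x\<bar>)) * u0 x)"
    unfolding real_norm_def abs_mult abs_of_pos[OF cole_hopf_init_pos] abs_of_pos[OF exp_gt_zero]
    by (intro AE_I2 mult_right_mono cole_hopf_init_bounds u0) simp
qed (use u0 in simp)

lemma integral_cole_hopf_init_mult:
  assumes c: "c > 0" and u0: "integrable lborel u0"
  shows "(LINT x|lborel. cole_hopf_init b c u0 x * u0 x) = wave_mass b c (LINT x|lborel. u0 x)"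
proof (cases "b = 0")
  case True
  then show ?thesis by (simp add: wave_mass_def cole_hopf_init_def)
next
  case False
  have "b / (2 * c) * (LINT x|lborel. cole_hopf_init b c u0 x * u0 x)
      = 1 - exp (- (b / (2 * c)) * (LINT x|lborel. u0 x))"
    using integral_exp_primitive[OF u0, of "b / (2 * c)"] unfolding cole_hopf_init_def .
  then show ?thesis using False c by (simp add: wave_mass_def field_simps)
qed

lemma primitive_gauss_bounds:
  assumes "c > 0"
  shows "0 \<le> primitive (gauss c) \<xi>" "primitive (gauss c) \<xi> \<le> (LINT x|lborel. gauss c x)"
proof -
  show "0 \<le> primitive (gauss c) \<xi>"
    unfolding set_lebesgue_integral_def by (rule integral_nonneg_AE) simp
  show "primitive (gauss c) \<xi> \<le> (LINT x|lborel. gauss c x)"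
    using primitive_bound[OF integrable_gauss[OF assms], of \<xi>] by simp
qed

lemma wave_denom_pos:
  assumes "c > 0"
  shows "0 < min 1 (exp (- (b / (2 * c)) * m)) * (LINT x|lborel. gauss c x)"
    and "min 1 (exp (- (b / (2 * c)) * m)) * (LINT x|lborel. gauss c x) \<le> wave_denom b c m \<xi>"
    and "0 < wave_denom b c m \<xi>"
proof -
  define h where "h = exp (- (b / (2 * c)) * m)"
  define I where "I = (LINT x|lborel. gauss c x)"
  define G where "G = primitive (gauss c) \<xi>"
  have G: "0 \<le> G" "G \<le> I" using primitive_gauss_bounds[OF assms] by (auto simp: G_def I_def)
  show 1: "0 < min 1 (exp (- (b / (2 * c)) * m)) * (LINT x|lborel. gauss c x)"
    using integral_gauss_pos[OF assms] by (auto simp: min_def)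
  have "min 1 h * I = min 1 h * (I - G) + min 1 h * G" by (simp add: algebra_simps)
  also have "\<dots> \<le> 1 * (I - G) + h * G" using G by (intro add_mono mult_right_mono) auto
  also have "\<dots> = wave_denom b c m \<xi>" by (simp add: wave_denom_def h_def I_def G_def algebra_simps)
  finally show "min 1 (exp (- (b / (2 * c)) * m)) * (LINT x|lborel. gauss c x) \<le> wave_denom b c m \<xi>"
    by (simp add: h_def I_def)
  with 1 show "0 < wave_denom b c m \<xi>" by linarith
qed

text \<open>
  At \<open>0\<close> the step takes its value \<open>h\<close> from the right half line, so that after \<open>s = \<xi> - z\<close> it is \<open>1 + (h - 1) * indicator {..\<xi>} s\<close>
  for every \<open>s\<close>, including \<open>s = \<xi>\<close>.
\<close>
lemma wave_denom_eq_smoothed_step: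
  assumes c: "c > 0"
  shows "wave_denom b c m \<xi> =
    (LINT z|lborel. gauss c (\<xi> - z) * (if z < 0 then 1 else exp (- (b / (2 * c)) * m)))"
proof -
  define h where "h = exp (- (b / (2 * c)) * m)"
  have "(LINT z|lborel. gauss c (\<xi> - z) * (if z < 0 then 1 else h))
      = (LINT s|lborel. gauss c s * (if \<xi> - s < 0 then 1 else h))"
    by (subst lborel_integral_real_affine[where c="-1" and t=\<xi>]) auto
  also have "\<dots> = (LINT s|lborel. gauss c s + (h - 1) * (indicator {..\<xi>} s *\<^sub>R gauss c s))"
    by (intro Bochner_Integration.integral_cong) (auto simp: algebra_simps)
  also have "\<dots> = (LINT s|lborel. gauss c s) + (h - 1) * primitive (gauss c) \<xi>"
    unfolding set_lebesgue_integral_def integral_mult_right_zero[symmetric]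
    by (intro Bochner_Integration.integral_add integrable_gauss c integrable_mult_right integrable_mult_indicator) simp
  finally show ?thesis unfolding wave_denom_def h_def by (rule sym)
qed

lemma smoothed_init_bounds:
  assumes c: "c > 0" and u0: "integrable lborel u0"
  shows "exp (- (\<bar>b / (2 * c)\<bar> * (LINT x|lborel. \<bar>u0 x\<bar>))) * (LINT x|lborel. gauss c x)
     \<le> (LINT z|lborel. gauss c (\<xi> - z) * cole_hopf_init b c u0 (z * r))"
    and "integrable lborel (\<lambda>z. gauss c (\<xi> - z) * cole_hopf_init b c u0 (z * r))"
proof -
  note borel_measurable_cole_hopf_init[OF u0, measurable]
  show i: "integrable lborel (\<lambda>z. gauss c (\<xi> - z) * cole_hopf_init b c u0 (z * r))"
  proof (rule Bochner_Integration.integrable_bound)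
    show "integrable lborel (\<lambda>z. gauss c (\<xi> - z) * exp (\<bar>b / (2 * c)\<bar> * (LINT x|lborel. \<bar>u0 x\<bar>)))"
      using integrable_gauss_diff[OF c] by simp
    show "AE z in lborel. norm (gauss c (\<xi> - z) * cole_hopf_init b c u0 (z * r))
        \<le> norm (gauss c (\<xi> - z) * exp (\<bar>b / (2 * c)\<bar> * (LINT x|lborel. \<bar>u0 x\<bar>)))"
      unfolding real_norm_def abs_mult abs_of_pos[OF cole_hopf_init_pos] abs_of_pos[OF exp_gt_zero]
      by (intro AE_I2 mult_left_mono cole_hopf_init_bounds u0) simp
  qed measurable
  have "exp (- (\<bar>b / (2 * c)\<bar> * (LINT x|lborel. \<bar>u0 x\<bar>))) * (LINT x|lborel. gauss c x)
    = (LINT z|lborel. gauss c (\<xi> - z) * exp (- (\<bar>b / (2 * c)\<bar> * (LINT x|lborel. \<bar>u0 x\<bar>))))"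
    by (simp add: integral_gauss_diff)
  also have "\<dots> \<le> (LINT z|lborel. gauss c (\<xi> - z) * cole_hopf_init b c u0 (z * r))"
    using integrable_gauss_diff[OF c] i
    by (intro integral_mono mult_left_mono cole_hopf_init_bounds u0) auto
  finally show "exp (- (\<bar>b / (2 * c)\<bar> * (LINT x|lborel. \<bar>u0 x\<bar>))) * (LINT x|lborel. gauss c x)
     \<le> (LINT z|lborel. gauss c (\<xi> - z) * cole_hopf_init b c u0 (z * r))" .
qed

lemma smoothed_init_uniform:
  assumes c: "c > 0" and u0: "integrable lborel u0" and e: "e > 0"
  shows "\<forall>\<^sub>F r in at_top. \<forall>\<xi>.
    \<bar>(LINT z|lborel. gauss c (\<xi> - z) * cole_hopf_init b c u0 (z * r)) - wave_denom b c (LINT x|lborel. u0 x) \<xi>\<bar> \<le> e"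
proof -
  define h where "h = exp (- (b / (2 * c)) * (LINT x|lborel. u0 x))"
  define H where "H z = (if z < 0 then 1 else h)" for z :: real
  define E where "E = cole_hopf_init b c u0"
  define B where "B = exp (\<bar>b / (2 * c)\<bar> * (LINT x|lborel. \<bar>u0 x\<bar>))"
  note borel_measurable_cole_hopf_init[OF u0, of b c, folded E_def, measurable]
  have [measurable]: "H \<in> borel_measurable borel" unfolding H_def by measurable
  have HB: "\<bar>H z\<bar> \<le> 1 + h" for z by (simp add: H_def h_def)
  have EB: "\<bar>E z\<bar> \<le> B" for z
    using cole_hopf_init_bounds(2)[OF u0] cole_hopf_init_pos[of b c u0 z] by (simp add: E_def B_def)
  have "\<forall>\<^sub>F r in at_top. \<forall>\<xi>. \<bar>LINT z|lborel. gauss c (\<xi> - z) * (E (z * r) - H (z * r))\<bar> \<le> e"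
  proof (rule gauss_smoothing_uniform[OF c _ _ _ _ e])
    show "\<bar>E x - H x\<bar> \<le> B + (1 + h)" for x using EB[of x] HB[of x] by linarith
    have *: "((\<lambda>x. E x - h) \<longlongrightarrow> h - h) at_top"
      unfolding E_def h_def by (intro tendsto_diff tendsto_const cole_hopf_init_at_top u0)
    have ev: "eventually (\<lambda>x. E x - h = E x - H x) at_top"
      using eventually_ge_at_top[of 0] by eventually_elim (simp add: H_def)
    show "((\<lambda>x. E x - H x) \<longlongrightarrow> 0) at_top"
      using iffD1[OF tendsto_cong[OF ev] *] by simp
    have *: "((\<lambda>x. E x - 1) \<longlongrightarrow> 1 - 1) at_bot"
      unfolding E_def h_def by (intro tendsto_diff tendsto_const cole_hopf_init_at_bot u0)
    have ev: "eventually (\<lambda>x. E x - 1 = E x - H x) at_bot"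
      using eventually_gt_at_bot[of 0] by eventually_elim (simp add: H_def)
    show "((\<lambda>x. E x - H x) \<longlongrightarrow> 0) at_bot"
      using iffD1[OF tendsto_cong[OF ev] *] by simp
  qed measurable
  then show ?thesis using eventually_gt_at_top[of 0]
  proof eventually_elim
    case (elim r)
    have "(LINT z|lborel. gauss c (\<xi> - z) * (E (z * r) - H (z * r)))
      = (LINT z|lborel. gauss c (\<xi> - z) * E (z * r)) - wave_denom b c (LINT x|lborel. u0 x) \<xi>" for \<xi>
    proof -
      have iE: "integrable lborel (\<lambda>z. gauss c (\<xi> - z) * E (z * r))"
        unfolding E_def by (rule smoothed_init_bounds[OF c u0])
      have iH: "integrable lborel (\<lambda>z. gauss c (\<xi> - z) * H z)"
        by (rule Bochner_Integration.integrable_bound[where f="\<lambda>z. gauss c (\<xi> - z) * (1 + h)"])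
          (use integrable_gauss_diff[OF c] HB in \<open>auto simp: abs_mult h_def intro!: mult_left_mono order.trans[OF HB[unfolded h_def]]\<close>)
      have "H (z * r) = H z" for z using elim by (simp add: H_def zero_less_mult_iff mult_less_0_iff)
      then have "(LINT z|lborel. gauss c (\<xi> - z) * (E (z * r) - H (z * r)))
        = (LINT z|lborel. gauss c (\<xi> - z) * E (z * r) - gauss c (\<xi> - z) * H z)"
        by (simp add: right_diff_distrib)
      also have "\<dots> = (LINT z|lborel. gauss c (\<xi> - z) * E (z * r)) - (LINT z|lborel. gauss c (\<xi> - z) * H z)"
        by (rule Bochner_Integration.integral_diff[OF iE iH])
      finally show ?thesis unfolding wave_denom_eq_smoothed_step[OF c] H_def h_def .
    qed
    then show ?case using elim by (simp add: E_def)
  qed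
qed

lemma abs_quotient_diff_le:
  fixes N D P Q \<kappa> :: real
  assumes "0 < \<kappa>" "\<kappa> \<le> D" "\<kappa> \<le> Q"
  shows "\<bar>N / D - P / Q\<bar> \<le> \<bar>N - P\<bar> / \<kappa> + \<bar>P\<bar> * \<bar>D - Q\<bar> / \<kappa>\<^sup>2"
proof -
  have "N / D - P / Q = (N - P) / D - P * (D - Q) / (D * Q)"
    using assms by (simp add: field_simps)
  then have "\<bar>N / D - P / Q\<bar> \<le> \<bar>(N - P) / D\<bar> + \<bar>P * (D - Q) / (D * Q)\<bar>"
    using abs_triangle_ineq4 by metis
  also have "\<dots> = \<bar>N - P\<bar> / D + \<bar>P\<bar> * \<bar>D - Q\<bar> / (D * Q)"
    using assms by (simp add: abs_mult)
  also have "\<dots> \<le> \<bar>N - P\<bar> / \<kappa> + \<bar>P\<bar> * \<bar>D - Q\<bar> / \<kappa>\<^sup>2"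
    using assms by (intro add_mono divide_left_mono) (auto simp: power2_eq_square intro!: mult_mono)
  finally show ?thesis .
qed

text \<open>
  The denominators are bounded below by a positive constant, so the error of the
  quotient is controlled linearly by the two separate errors. The second one carries the factor
  \<open>gauss c \<xi>\<close>, which is what makes a merely uniform bound on the denominators enough for \<open>L\<^sup>1\<close>
  convergence.
\<close>
lemma rescaled_solution_close:
  assumes c: "c > 0" and u0: "integrable lborel u0" and m: "(LINT x|lborel. u0 x) = m"
  obtains A where "A > 0"
    "\<And>r \<xi>. \<bar>rescaled_solution b c u0 r \<xi> - diffusion_wave b c m \<xi>\<bar> \<le>
      A * \<bar>(LINT y|lborel. gauss c (\<xi> - y / r) * (cole_hopf_init b c u0 y * u0 y)) - wave_mass b c m * gauss c \<xi>\<bar>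
      + A * gauss c \<xi> * \<bar>(LINT z|lborel. gauss c (\<xi> - z) * cole_hopf_init b c u0 (z * r)) - wave_denom b c m \<xi>\<bar>"
proof -
  \<comment> \<open>A common lower bound for both denominators.\<close>
  define \<kappa> where "\<kappa> = min (exp (- (\<bar>b / (2 * c)\<bar> * (LINT x|lborel. \<bar>u0 x\<bar>))) * (LINT x|lborel. gauss c x))
     (min 1 (exp (- (b / (2 * c)) * m)) * (LINT x|lborel. gauss c x))"
  have \<kappa>: "\<kappa> > 0" unfolding \<kappa>_def using wave_denom_pos(1)[OF c, of b m] integral_gauss_pos[OF c]
    by (simp del: min_less_iff_conj add: min_def)
  define A where "A = 1 / \<kappa> + \<bar>wave_mass b c m\<bar> / \<kappa>\<^sup>2"
  show thesis
  proof (rule that[of A])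
    show "A > 0" unfolding A_def using \<kappa> by (simp add: add_pos_nonneg)
    fix r \<xi>
    define N where "N = (LINT y|lborel. gauss c (\<xi> - y / r) * (cole_hopf_init b c u0 y * u0 y))"
    define D where "D = (LINT z|lborel. gauss c (\<xi> - z) * cole_hopf_init b c u0 (z * r))"
    define P where "P = wave_mass b c m * gauss c \<xi>"
    define Q where "Q = wave_denom b c m \<xi>"
    have "\<kappa> \<le> D" "\<kappa> \<le> Q"
      using smoothed_init_bounds(1)[OF c u0, of b \<xi> r] wave_denom_pos(2)[OF c, of b m \<xi>]
      unfolding \<kappa>_def D_def Q_def by linarith+
    then have "\<bar>N / D - P / Q\<bar> \<le> \<bar>N - P\<bar> / \<kappa> + \<bar>P\<bar> * \<bar>D - Q\<bar> / \<kappa>\<^sup>2"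
      by (rule abs_quotient_diff_le[OF \<kappa>])
    also have "\<dots> = 1 / \<kappa> * \<bar>N - P\<bar> + \<bar>wave_mass b c m\<bar> / \<kappa>\<^sup>2 * (gauss c \<xi> * \<bar>D - Q\<bar>)"
      by (simp add: P_def abs_mult)
    also have "\<dots> \<le> A * \<bar>N - P\<bar> + A * (gauss c \<xi> * \<bar>D - Q\<bar>)"
      unfolding A_def using \<kappa> by (intro add_mono mult_right_mono) auto
    finally show "\<bar>rescaled_solution b c u0 r \<xi> - diffusion_wave b c m \<xi>\<bar> \<le>
      A * \<bar>(LINT y|lborel. gauss c (\<xi> - y / r) * (cole_hopf_init b c u0 y * u0 y)) - wave_mass b c m * gauss c \<xi>\<bar>
      + A * gauss c \<xi> * \<bar>(LINT z|lborel. gauss c (\<xi> - z) * cole_hopf_init b c u0 (z * r)) - wave_denom b c m \<xi>\<bar>"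
      by (simp add: rescaled_solution_def diffusion_wave_def N_def D_def P_def Q_def mult.assoc)
  qed
qed

lemma rescaled_solution_uniform:
  assumes c: "c > 0" and u0: "integrable lborel u0" and m: "(LINT x|lborel. u0 x) = m" and e: "e > 0"
  shows "\<forall>\<^sub>F r in at_top. \<forall>\<xi>. \<bar>rescaled_solution b c u0 r \<xi> - diffusion_wave b c m \<xi>\<bar> \<le> e"
proof -
  obtain A where A: "A > 0"
    "\<And>r \<xi>. \<bar>rescaled_solution b c u0 r \<xi> - diffusion_wave b c m \<xi>\<bar> \<le>
      A * \<bar>(LINT y|lborel. gauss c (\<xi> - y / r) * (cole_hopf_init b c u0 y * u0 y)) - wave_mass b c m * gauss c \<xi>\<bar>
      + A * gauss c \<xi> * \<bar>(LINT z|lborel. gauss c (\<xi> - z) * cole_hopf_init b c u0 (z * r)) - wave_denom b c m \<xi>\<bar>"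
    by (rule rescaled_solution_close[OF c u0 m, of b]) blast
  define d where "d = e / (2 * A)"
  have d: "d > 0" using A e by (simp add: d_def)
  obtain s where s: "(s \<longlongrightarrow> 0) at_top"
    "\<And>r \<xi>. \<bar>(LINT y|lborel. gauss c (\<xi> - y / r) * (cole_hopf_init b c u0 y * u0 y)) - wave_mass b c m * gauss c \<xi>\<bar> \<le> s r"
    using gauss_average_uniform[OF c integrable_cole_hopf_init_mult[OF u0, of b c]]
    unfolding integral_cole_hopf_init_mult[OF c u0] m by blast
  show ?thesis
    using order_tendstoD(2)[OF s(1) d] smoothed_init_uniform[OF c u0 d, of b]
  proof eventually_elim
    case (elim r)
    show ?case
    proof
      fix \<xi>
      let ?D = "\<bar>(LINT z|lborel. gauss c (\<xi> - z) * cole_hopf_init b c u0 (z * r)) - wave_denom b c m \<xi>\<bar>"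
      have "\<bar>rescaled_solution b c u0 r \<xi> - diffusion_wave b c m \<xi>\<bar> \<le> A * s r + A * (gauss c \<xi> * ?D)"
        using order.trans[OF A(2)[of r \<xi>] add_right_mono[OF mult_left_mono[OF s(2)[of \<xi> r]]]] A(1)
        by (simp add: mult.assoc)
      also have "\<dots> \<le> A * d + A * (1 * d)"
        using elim A(1) gauss_le_1[OF c, of \<xi>] unfolding m
        by (intro add_mono mult_left_mono mult_mono) auto
      also have "\<dots> = e" using A(1) by (simp add: d_def)
      finally show "\<bar>rescaled_solution b c u0 r \<xi> - diffusion_wave b c m \<xi>\<bar> \<le> e" .
    qed
  qed
qed

lemma rescaled_solution_L1:
  assumes c: "c > 0" and u0: "integrable lborel u0" and m: "(LINT x|lborel. u0 x) = m" and e: "e > 0"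
  shows "\<forall>\<^sub>F r in at_top. (\<integral>\<^sup>+ \<xi>. ennreal \<bar>rescaled_solution b c u0 r \<xi> - diffusion_wave b c m \<xi>\<bar> \<partial>lborel) \<le> ennreal e"
proof -
  obtain A where A: "A > 0"
    "\<And>r \<xi>. \<bar>rescaled_solution b c u0 r \<xi> - diffusion_wave b c m \<xi>\<bar> \<le>
      A * \<bar>(LINT y|lborel. gauss c (\<xi> - y / r) * (cole_hopf_init b c u0 y * u0 y)) - wave_mass b c m * gauss c \<xi>\<bar>
      + A * gauss c \<xi> * \<bar>(LINT z|lborel. gauss c (\<xi> - z) * cole_hopf_init b c u0 (z * r)) - wave_denom b c m \<xi>\<bar>"
    by (rule rescaled_solution_close[OF c u0 m, of b]) blast
  have [measurable]: "u0 \<in> borel_measurable borel" using u0 by auto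
  note borel_measurable_cole_hopf_init[OF u0, measurable]
  define I where "I = (LINT x|lborel. gauss c x)"
  have I: "I > 0" unfolding I_def by (rule integral_gauss_pos[OF c])
  define N where "N r \<xi> = \<bar>(LINT y|lborel. gauss c (\<xi> - y / r) * (cole_hopf_init b c u0 y * u0 y)) - wave_mass b c m * gauss c \<xi>\<bar>" for r \<xi>
  have [measurable]: "N r \<in> borel_measurable borel" for r unfolding N_def by measurable
  define d where "d = e / (2 * A)"
  have d: "d > 0" using A e by (simp add: d_def)
  have "((\<lambda>r. \<integral>\<^sup>+ \<xi>. ennreal (N r \<xi>) \<partial>lborel) \<longlongrightarrow> 0) at_top"
    using gauss_average_L1[OF c integrable_cole_hopf_init_mult[OF u0, of b c]]
    unfolding integral_cole_hopf_init_mult[OF c u0] m N_def .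
  then have "\<forall>\<^sub>F r in at_top. (\<integral>\<^sup>+ \<xi>. ennreal (N r \<xi>) \<partial>lborel) < ennreal d"
    using d by (intro order_tendstoD) auto
  moreover have "0 < d / I" using d I by simp
  note smoothed_init_uniform[OF c u0 this, of b]
  ultimately show ?thesis
  proof eventually_elim
    case 1: (elim r)
    have "(\<integral>\<^sup>+ \<xi>. ennreal \<bar>rescaled_solution b c u0 r \<xi> - diffusion_wave b c m \<xi>\<bar> \<partial>lborel)
      \<le> (\<integral>\<^sup>+ \<xi>. ennreal A * ennreal (N r \<xi>) + ennreal (A * d / I) * ennreal (gauss c \<xi>) \<partial>lborel)"
    proof (rule nn_integral_mono)
      fix \<xi>
      have "\<bar>rescaled_solution b c u0 r \<xi> - diffusion_wave b c m \<xi>\<bar> \<le> A * N r \<xi> + A * gauss c \<xi> * (d / I)"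
        unfolding N_def using 1(2) A(1) unfolding m
        by (intro order.trans[OF A(2)] add_left_mono mult_left_mono) auto
      then show "ennreal \<bar>rescaled_solution b c u0 r \<xi> - diffusion_wave b c m \<xi>\<bar>
         \<le> ennreal A * ennreal (N r \<xi>) + ennreal (A * d / I) * ennreal (gauss c \<xi>)"
        using A(1) d I by (simp add: ennreal_mult[symmetric] ennreal_plus[symmetric] N_def mult_ac del: ennreal_plus)
    qed
    also have "\<dots> = ennreal A * (\<integral>\<^sup>+ \<xi>. ennreal (N r \<xi>) \<partial>lborel) + ennreal (A * d / I) * (\<integral>\<^sup>+ \<xi>. ennreal (gauss c \<xi>) \<partial>lborel)"
      by (simp add: nn_integral_add nn_integral_cmult)
    also have "(\<integral>\<^sup>+ \<xi>. ennreal (gauss c \<xi>) \<partial>lborel) = ennreal I"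
      unfolding I_def by (intro nn_integral_eq_integral integrable_gauss c) auto
    also have "ennreal A * (\<integral>\<^sup>+ \<xi>. ennreal (N r \<xi>) \<partial>lborel) + ennreal (A * d / I) * ennreal I
       \<le> ennreal A * ennreal d + ennreal (A * d / I) * ennreal I"
      using 1(1) by (intro add_mono mult_left_mono) auto
    also have "\<dots> = ennreal (A * d + A * d / I * I)"
      using A(1) I d by (subst ennreal_plus) (simp_all only: ennreal_mult' less_imp_le mult_nonneg_nonneg divide_nonneg_nonneg)
    also have "A * d + A * d / I * I = e"
      using A(1) I by (simp add: d_def)
    finally show ?case .
  qed
qed

lemma borel_measurable_rescaled_solution:
  assumes "integrable lborel u0"
  shows "rescaled_solution b c u0 r \<in> borel_measurable borel"
proof -
  have [measurable]: "u0 \<in> borel_measurable borel" using assms by auto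
  note borel_measurable_cole_hopf_init[OF assms, measurable]
  show ?thesis unfolding rescaled_solution_def by measurable
qed

section \<open>Lp norms\<close>

text \<open>
  For functions bounded by \<open>1\<close>, the \<open>p\<close>-th power is at most the function itself, so smallness in \<open>L\<^sup>\<infinity>\<close>
  and in \<open>L\<^sup>1\<close> gives smallness in every \<open>L\<^sup>p\<close>. For \<open>p = \<infinity>\<close> the exponent \<open>enn2real p\<close> is \<open>0\<close>, and the
  bound on the integral reads \<open>1\<close>.
\<close>
lemma Lp_norm_le:
  assumes p: "1 \<le> p" and d: "0 < d" "d \<le> 1"
    and sup: "\<And>x. \<bar>f x\<bar> \<le> d" and L1: "(\<integral>\<^sup>+ x. ennreal \<bar>f x\<bar> \<partial>lborel) \<le> ennreal (d powr enn2real p)"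
  shows "Lp_norm p f \<le> ennreal d"
proof (cases "p = \<infinity>")
  case True
  then show ?thesis using sup by (auto simp: Lp_norm_def intro!: SUP_least ennreal_leI)
next
  case False
  define q where "q = enn2real p"
  have q: "q \<ge> 1" using p False enn2real_mono[of 1 p] unfolding q_def
    by (simp add: top.not_eq_extremum)
  define J where "J = (\<integral>\<^sup>+ x. ennreal (\<bar>f x\<bar> powr q) \<partial>lborel)"
  have "\<bar>f x\<bar> powr q \<le> \<bar>f x\<bar>" for x
  proof (cases "f x = 0")
    case False
    then have "\<bar>f x\<bar> powr q \<le> \<bar>f x\<bar> powr 1"
      using sup[of x] d q by (intro powr_mono') auto
    then show ?thesis by simp
  qed simp
  then have "J \<le> (\<integral>\<^sup>+ x. ennreal \<bar>f x\<bar> \<partial>lborel)"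
    unfolding J_def by (intro nn_integral_mono ennreal_leI)
  also note L1
  finally have J: "J \<le> ennreal (d powr q)" by (simp add: q_def)
  then have "J \<noteq> \<infinity>" using ennreal_less_top[of "d powr q"] by (auto simp: top_unique)
  have "enn2real J \<le> d powr q" using J by (metis enn2real_leI powr_ge_zero)
  then have "enn2real J powr (1 / q) \<le> (d powr q) powr (1 / q)"
    using q by (intro powr_mono2) auto
  also have "\<dots> = d" using q d by (simp add: powr_powr)
  finally show ?thesis using False \<open>J \<noteq> \<infinity>\<close>
    unfolding Lp_norm_def J_def q_def Let_def by (simp add: ennreal_leI)
qed

text \<open>
  The exact lower bound \<open>e * l powr (1/p)\<close> is weakened to \<open>e * l\<close>, as \<open>l \<le> 1\<close>, to have one bound for all
  \<open>p\<close>.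
\<close>
lemma Lp_norm_ge:
  assumes p: "1 \<le> p" and e: "0 < e" and l: "0 < l" "l \<le> 1"
    and low: "\<And>x. x \<in> {a..a + l} \<Longrightarrow> e \<le> \<bar>f x\<bar>"
  shows "ennreal (e * l) \<le> Lp_norm p f"
proof (cases "p = \<infinity>")
  case True
  have "e * l \<le> e * 1" using e l by (intro mult_left_mono) auto
  also have "\<dots> \<le> \<bar>f a\<bar>" using low[of a] l by simp
  finally have "ennreal (e * l) \<le> ennreal \<bar>f a\<bar>" by (rule ennreal_leI)
  also have "\<dots> \<le> Lp_norm p f" using True by (auto simp: Lp_norm_def intro: SUP_upper)
  finally show ?thesis .
next
  case False
  define q where "q = enn2real p"
  have q: "q \<ge> 1" using p False enn2real_mono[of 1 p] unfolding q_def
    by (simp add: top.not_eq_extremum)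
  define J where "J = (\<integral>\<^sup>+ x. ennreal (\<bar>f x\<bar> powr q) \<partial>lborel)"
  show ?thesis
  proof (cases "J = \<infinity>")
    case True
    then show ?thesis using False unfolding Lp_norm_def J_def q_def by simp
  next
    case Jfin: False
    have "ennreal (e powr q * l) = (\<integral>\<^sup>+ x. ennreal (e powr q) * indicator {a..a + l} x \<partial>lborel)"
      using l e by (simp add: nn_integral_cmult_indicator ennreal_mult')
    also have "\<dots> \<le> J"
      unfolding J_def
    proof (rule nn_integral_mono)
      fix x
      have "e powr q \<le> \<bar>f x\<bar> powr q" if "x \<in> {a..a + l}"
        using low[OF that] e q by (intro powr_mono2) auto
      then show "ennreal (e powr q) * indicator {a..a + l} x \<le> ennreal (\<bar>f x\<bar> powr q)"
        by (auto simp: indicator_def ennreal_leI)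
    qed
    finally have "e powr q * l \<le> enn2real J"
      using Jfin l e by (metis enn2real_ennreal enn2real_mono infinity_ennreal_def mult_nonneg_nonneg powr_ge_zero less_imp_le top.not_eq_extremum)
    then have "(e powr q * l) powr (1 / q) \<le> enn2real J powr (1 / q)"
      using q l by (intro powr_mono2) auto
    moreover have "(e powr q * l) powr (1 / q) = e * l powr (1 / q)"
      using e l q by (simp add: powr_mult powr_powr)
    moreover have "l powr 1 \<le> l powr (1 / q)"
      using l q by (intro powr_mono') auto
    then have "e * l \<le> e * l powr (1 / q)" using e l by simp
    ultimately have "e * l \<le> enn2real J powr (1 / q)" by linarith
    then show ?thesis using False Jfin
      unfolding Lp_norm_def J_def q_def Let_def by (simp add: ennreal_leI)
  qed
qed

text \<open>
  The weight \<open>t powr ((1 - 1/p)/2)\<close> is the factor by which the \<open>L\<^sup>p\<close> norm changes under the diffusive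
  scaling \<open>v \<mapsto> sqrt t * v (x0 + sqrt t * \<xi>)\<close>: dilation contributes \<open>t powr (- 1/(2 p))\<close> and the
  amplitude \<open>t powr (1/2)\<close>.
\<close>
lemma scaled_Lp_dist_rescale:
  assumes p: "1 \<le> p" and t: "t > 0" and [measurable]: "(\<lambda>x. u x t - v x t) \<in> borel_measurable borel"
  shows "scaled_Lp_dist p u v t =
    Lp_norm p (\<lambda>\<xi>. sqrt t * (u (x0 + sqrt t * \<xi>) t - v (x0 + sqrt t * \<xi>) t))"
proof -
  define f where "f x = u x t - v x t" for x
  have [measurable]: "f \<in> borel_measurable borel" unfolding f_def by measurable
  show ?thesis
  proof (cases "p = \<infinity>")
    case True
    have surj: "range (\<lambda>\<xi>. x0 + sqrt t * \<xi>) = UNIV"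
    proof (rule surjI)
      show "x0 + sqrt t * ((x - x0) / sqrt t) = x" for x using t by simp
    qed
    have "(SUP x. ennreal \<bar>f x\<bar>) = (SUP x\<in>range (\<lambda>\<xi>. x0 + sqrt t * \<xi>). ennreal \<bar>f x\<bar>)"
      by (simp only: surj)
    also have "\<dots> = (SUP \<xi>. ennreal \<bar>f (x0 + sqrt t * \<xi>)\<bar>)"
      by (simp add: image_image)
    finally have "ennreal (sqrt t) * (SUP x. ennreal \<bar>f x\<bar>) = (SUP \<xi>. ennreal (sqrt t) * ennreal \<bar>f (x0 + sqrt t * \<xi>)\<bar>)"
      by (simp add: SUP_mult_left_ennreal)
    then show ?thesis using True t
      by (simp add: scaled_Lp_dist_def Lp_norm_def f_def powr_half_sqrt abs_mult ennreal_mult)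
  next
    case False
    define q where "q = enn2real p"
    have q: "q \<ge> 1" using p False enn2real_mono[of 1 p] unfolding q_def
      by (simp add: top.not_eq_extremum)
    have pq: "p = ennreal q" using False by (simp add: q_def top.not_eq_extremum)
    have inv: "enn2real (inverse p) = 1 / q"
      using q by (simp add: pq inverse_ennreal inverse_eq_divide)
    define J where "J = (\<integral>\<^sup>+ x. ennreal (\<bar>f x\<bar> powr q) \<partial>lborel)"
    define K where "K = (\<integral>\<^sup>+ \<xi>. ennreal (\<bar>f (x0 + sqrt t * \<xi>)\<bar> powr q) \<partial>lborel)"
    have JK: "J = ennreal (sqrt t) * K"
      unfolding J_def K_def using t by (subst nn_integral_real_affine[where c="sqrt t" and t=x0]) auto
    have L: "(\<integral>\<^sup>+ \<xi>. ennreal (\<bar>sqrt t * f (x0 + sqrt t * \<xi>)\<bar> powr q) \<partial>lborel) = ennreal (t powr (q / 2)) * K"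
    proof -
      have "\<bar>sqrt t * f (x0 + sqrt t * \<xi>)\<bar> powr q = t powr (q / 2) * \<bar>f (x0 + sqrt t * \<xi>)\<bar> powr q" for \<xi>
        using t by (simp add: abs_mult powr_mult powr_half_sqrt[symmetric] powr_powr)
      then show ?thesis unfolding K_def
        by (simp add: ennreal_mult nn_integral_cmult)
    qed
    have L': "Lp_norm p (\<lambda>\<xi>. sqrt t * f (x0 + sqrt t * \<xi>)) =
       (let I = ennreal (t powr (q / 2)) * K in if I = \<infinity> then \<infinity> else ennreal (enn2real I powr (1 / q)))"
      unfolding Lp_norm_def L[symmetric] using False by (simp add: q_def Let_def)
    have S: "scaled_Lp_dist p u v t = ennreal (t powr (1 / 2 * (1 - 1 / q))) *
       (if J = \<infinity> then \<infinity> else ennreal (enn2real J powr (1 / q)))"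
      unfolding scaled_Lp_dist_def inv Lp_norm_def J_def f_def q_def using False by (simp add: Let_def)
    show ?thesis
    proof (cases "K = \<infinity>")
      case True
      then show ?thesis using S L' t unfolding JK f_def
        by (simp add: ennreal_mult_top Let_def)
    next
      case False
      then obtain k where k: "K = ennreal k" "k \<ge> 0" by (cases K) auto
      have J: "J = ennreal (sqrt t * k)" using JK k t by (simp add: ennreal_mult)
      have T: "ennreal (t powr (q / 2)) * K = ennreal (t powr (q / 2) * k)" using k by (simp add: ennreal_mult)
      have "t powr (1 / 2 * (1 - 1 / q)) * (sqrt t * k) powr (1 / q)
        = t powr (1 / 2 * (1 - 1 / q)) * t powr (1 / 2 * (1 / q)) * k powr (1 / q)"
        using t k by (simp add: powr_mult powr_half_sqrt[symmetric] powr_powr)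
      also have "t powr (1 / 2 * (1 - 1 / q)) * t powr (1 / 2 * (1 / q)) = t powr (1 / 2)"
        unfolding powr_add[symmetric] by (simp add: right_diff_distrib)
      also have "t powr (1 / 2) * k powr (1 / q) = (t powr (q / 2) * k) powr (1 / q)"
        using t k q by (simp add: powr_mult powr_powr)
      finally show ?thesis using S L' t k(2) unfolding J T f_def
        by (simp add: ennreal_mult[symmetric] Let_def)
    qed
  qed
qed

section \<open>Diffusion waves determine the parameters\<close>

lemma gauss_tendsto_0:
  assumes "c > 0"
  shows "(gauss c \<longlongrightarrow> 0) at_top" and "(gauss c \<longlongrightarrow> 0) at_bot"
proof -
  have "filterlim (\<lambda>x::real. x\<^sup>2 * (1 / (4 * c))) at_top at_top"
    using assms by (intro filterlim_at_top_mult_tendsto_pos[OF tendsto_const] filterlim_pow_at_top filterlim_ident) auto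
  then have "filterlim (\<lambda>x::real. - (x\<^sup>2 / (4 * c))) at_bot at_top"
    by (simp add: filterlim_uminus_at_bot)
  then show 1: "(gauss c \<longlongrightarrow> 0) at_top"
    unfolding gauss_def by (rule filterlim_compose[OF exp_at_bot])
  then show "(gauss c \<longlongrightarrow> 0) at_bot"
    by (simp add: filterlim_at_bot_mirror)
qed

lemma isCont_wave_denom:
  assumes "c > 0"
  shows "isCont (wave_denom b c m) \<xi>"
  unfolding wave_denom_def by (intro continuous_intros isCont_primitive integrable_gauss assms)

lemma isCont_diffusion_wave:
  assumes "c > 0"
  shows "isCont (diffusion_wave b c m) \<xi>"
  unfolding diffusion_wave_def
  using wave_denom_pos(3)[OF assms, of b m \<xi>]
  by (intro continuous_intros isCont_wave_denom isCont_gauss assms) auto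

lemma wave_mass_nonzero: "c > 0 \<Longrightarrow> m \<noteq> 0 \<Longrightarrow> wave_mass b c m \<noteq> 0"
  by (simp add: wave_mass_def)

lemma wave_denom_limits:
  assumes c: "c > 0"
  shows "(wave_denom b c m \<longlongrightarrow> (LINT x|lborel. gauss c x)) at_bot"
    and "(wave_denom b c m \<longlongrightarrow> exp (- (b / (2 * c)) * m) * (LINT x|lborel. gauss c x)) at_top"
proof -
  show "(wave_denom b c m \<longlongrightarrow> (LINT x|lborel. gauss c x)) at_bot"
    using tendsto_add[OF tendsto_const tendsto_mult[OF tendsto_const primitive_at_bot[OF integrable_gauss[OF c]]]]
    unfolding wave_denom_def by (metis add.right_neutral mult_zero_right)
  have "exp (- (b / (2 * c)) * m) * (LINT x|lborel. gauss c x) =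
    (LINT x|lborel. gauss c x) + (exp (- (b / (2 * c)) * m) - 1) * (LINT x|lborel. gauss c x)"
    by (simp add: algebra_simps)
  then show "(wave_denom b c m \<longlongrightarrow> exp (- (b / (2 * c)) * m) * (LINT x|lborel. gauss c x)) at_top"
    using tendsto_add[OF tendsto_const tendsto_mult[OF tendsto_const primitive_at_top[OF integrable_gauss[OF c]]]]
    unfolding wave_denom_def by metis
qed

lemma diffusion_wave_over_gauss_limits:
  assumes c: "c > 0"
  shows "((\<lambda>\<xi>. diffusion_wave b c m \<xi> / gauss c \<xi>) \<longlongrightarrow> wave_mass b c m / (LINT x|lborel. gauss c x)) at_bot"
    and "((\<lambda>\<xi>. diffusion_wave b c m \<xi> / gauss c \<xi>) \<longlongrightarrow>
       wave_mass b c m / (exp (- (b / (2 * c)) * m) * (LINT x|lborel. gauss c x))) at_top"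
proof -
  have eq: "(\<lambda>\<xi>. diffusion_wave b c m \<xi> / gauss c \<xi>) = (\<lambda>\<xi>. wave_mass b c m / wave_denom b c m \<xi>)"
    by (simp add: diffusion_wave_def fun_eq_iff)
  have I: "(LINT x|lborel. gauss c x) \<noteq> 0" using integral_gauss_pos[OF c] by simp
  show "((\<lambda>\<xi>. diffusion_wave b c m \<xi> / gauss c \<xi>) \<longlongrightarrow> wave_mass b c m / (LINT x|lborel. gauss c x)) at_bot"
    unfolding eq by (intro tendsto_divide tendsto_const wave_denom_limits c I)
  show "((\<lambda>\<xi>. diffusion_wave b c m \<xi> / gauss c \<xi>) \<longlongrightarrow>
       wave_mass b c m / (exp (- (b / (2 * c)) * m) * (LINT x|lborel. gauss c x))) at_top"
    unfolding eq by (intro tendsto_divide tendsto_const wave_denom_limits c no_zero_divisors I exp_not_eq_zero)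
qed

lemma diffusion_wave_tendsto_0:
  assumes c: "c > 0"
  shows "(diffusion_wave b c m \<longlongrightarrow> 0) at_bot" and "(diffusion_wave b c m \<longlongrightarrow> 0) at_top"
  using tendsto_mult[OF diffusion_wave_over_gauss_limits(1)[OF c, of b m] gauss_tendsto_0(2)[OF c]]
    tendsto_mult[OF diffusion_wave_over_gauss_limits(2)[OF c, of b m] gauss_tendsto_0(1)[OF c]]
  by simp_all

lemma gauss_quotient_tendsto_0:
  assumes "c > 0" "c' > 0" "c < c'"
  shows "((\<lambda>x. gauss c x / gauss c' x) \<longlongrightarrow> 0) at_top"
proof -
  define d where "d = c * c' / (c' - c)"
  have d: "d > 0" using assms by (simp add: d_def)
  have "gauss c x / gauss c' x = gauss d x" for x
  proof -
    have "x\<^sup>2 / (4 * c) - x\<^sup>2 / (4 * c') = x\<^sup>2 / (4 * d)"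
      using assms unfolding d_def by (simp add: field_simps)
    then show ?thesis unfolding gauss_def by (simp add: exp_diff[symmetric])
  qed
  then show ?thesis using gauss_tendsto_0(1)[OF d] by simp
qed

text \<open>
  The wave decays like \<open>gauss c\<close> at \<open>\<infinity>\<close>, up to a nonzero constant, so two equal waves
  cannot have different Gaussian rates.
\<close>
lemma diffusion_wave_viscosity_le:
  assumes c: "c > 0" and c': "c' > 0" and m: "m \<noteq> 0"
    and eq: "diffusion_wave b c m = diffusion_wave b' c' m"
  shows "c' \<le> c"
proof (rule ccontr)
  assume "\<not> c' \<le> c"
  then have "c < c'" by simp
  note L = diffusion_wave_over_gauss_limits(2)
  have "((\<lambda>\<xi>. diffusion_wave b c m \<xi> / gauss c \<xi> * (gauss c \<xi> / gauss c' \<xi>)) \<longlongrightarrow>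
     wave_mass b c m / (exp (- (b / (2 * c)) * m) * (LINT x|lborel. gauss c x)) * 0) at_top"
    by (intro tendsto_mult L gauss_quotient_tendsto_0 c c' \<open>c < c'\<close>)
  then have "((\<lambda>\<xi>. diffusion_wave b' c' m \<xi> / gauss c' \<xi>) \<longlongrightarrow> 0) at_top"
    by (simp add: eq)
  from tendsto_unique[OF trivial_limit_at_top_linorder this L[OF c']]
  have "wave_mass b' c' m / (exp (- (b' / (2 * c')) * m) * (LINT x|lborel. gauss c' x)) = 0" by simp
  then show False using wave_mass_nonzero[OF c' m] integral_gauss_pos[OF c'] by simp
qed

text \<open>
  Once the viscosities agree, dividing by the Gaussian leaves two limits, at \<open>-\<infinity>\<close> and at \<open>\<infinity>\<close>, the
  second being \<open>exp (b m / (2 c))\<close> times the first. This factor is injective in \<open>b\<close> as \<open>m \<noteq> 0\<close>.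
\<close>
lemma diffusion_wave_determines_parameters:
  assumes c: "c > 0" and c': "c' > 0" and m: "m \<noteq> 0"
    and eq: "diffusion_wave b c m = diffusion_wave b' c' m"
  shows "b = b'" "c = c'"
proof -
  show cc: "c = c'"
    using diffusion_wave_viscosity_le[OF c c' m eq] diffusion_wave_viscosity_le[OF c' c m eq[symmetric]] by simp
  note I = integral_gauss_pos[OF c]
  have "wave_mass b c m / (LINT x|lborel. gauss c x) = wave_mass b' c m / (LINT x|lborel. gauss c x)"
    by (rule tendsto_unique[OF trivial_limit_at_bot_linorder diffusion_wave_over_gauss_limits(1)[OF c, of b m]])
      (use diffusion_wave_over_gauss_limits(1)[OF c, of b' m] eq cc in simp)
  then have mass: "wave_mass b c m = wave_mass b' c m" using I by simp
  have "wave_mass b c m / (exp (- (b / (2 * c)) * m) * (LINT x|lborel. gauss c x))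
      = wave_mass b' c m / (exp (- (b' / (2 * c)) * m) * (LINT x|lborel. gauss c x))"
    by (rule tendsto_unique[OF trivial_limit_at_top_linorder diffusion_wave_over_gauss_limits(2)[OF c, of b m]])
      (use diffusion_wave_over_gauss_limits(2)[OF c, of b' m] eq cc in simp)
  then have "exp (- (b / (2 * c)) * m) = exp (- (b' / (2 * c)) * m)"
    unfolding mass using I wave_mass_nonzero[OF c m, of b'] by (simp add: field_simps del: exp_inj_iff)
  then show "b = b'" using c m by simp
qed

section \<open>Large-time distance of two solutions\<close>

text \<open>
  In the frame moving with the first solution, the second one drifts by \<open>(a' - a) r\<^sup>2\<close>, which is
  \<open>(a' - a) r\<close> in units of the diffusive length \<open>r\<close>; hence the shifted argument.
\<close>
lemma scaled_Lp_dist_burgers: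
  assumes c: "c > 0" "c' > 0" and u0: "integrable lborel u0" "integrable lborel u0'"
    and u: "\<And>x t. t > 0 \<Longrightarrow> u x t = cole_hopf a b c u0 x t"
    and u': "\<And>x t. t > 0 \<Longrightarrow> u' x t = cole_hopf a' b' c' u0' x t"
    and p: "1 \<le> p" and r: "r > 0"
  shows "scaled_Lp_dist p u u' (r\<^sup>2) =
    Lp_norm p (\<lambda>\<xi>. rescaled_solution b c u0 r \<xi> - rescaled_solution b' c' u0' r (\<xi> + (a - a') * r))"
proof -
  have r2: "r\<^sup>2 > 0" "sqrt (r\<^sup>2) = r" using r by simp_all
  have [measurable]: "u0 \<in> borel_measurable borel" "u0' \<in> borel_measurable borel" using u0 by auto
  note borel_measurable_cole_hopf_init[OF u0(1), measurable]
  note borel_measurable_cole_hopf_init[OF u0(2), measurable]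
  have "(\<lambda>x. cole_hopf a b c u0 x (r\<^sup>2) - cole_hopf a' b' c' u0' x (r\<^sup>2)) \<in> borel_measurable borel"
    unfolding cole_hopf_def cole_hopf_phi_def by measurable
  then have meas: "(\<lambda>x. u x (r\<^sup>2) - u' x (r\<^sup>2)) \<in> borel_measurable borel"
    using u u' r2 by simp
  have "sqrt (r\<^sup>2) * (u (a * r\<^sup>2 + sqrt (r\<^sup>2) * \<xi>) (r\<^sup>2) - u' (a * r\<^sup>2 + sqrt (r\<^sup>2) * \<xi>) (r\<^sup>2))
     = rescaled_solution b c u0 r \<xi> - rescaled_solution b' c' u0' r (\<xi> + (a - a') * r)" for \<xi>
  proof -
    have "r * cole_hopf a b c u0 (a * r\<^sup>2 + r * \<xi>) (r\<^sup>2) = rescaled_solution b c u0 r \<xi>"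
      by (rule cole_hopf_rescaled[OF c(1) r]) (simp add: algebra_simps)
    moreover have "r * cole_hopf a' b' c' u0' (a * r\<^sup>2 + r * \<xi>) (r\<^sup>2) = rescaled_solution b' c' u0' r (\<xi> + (a - a') * r)"
      by (rule cole_hopf_rescaled[OF c(2) r]) (simp add: algebra_simps power2_eq_square)
    ultimately show ?thesis using u u' r2 by (simp add: right_diff_distrib)
  qed
  then show ?thesis
    using scaled_Lp_dist_rescale[where u=u and v=u', OF p r2(1) meas, of "a * r\<^sup>2"] by simp
qed

text \<open>
  Solutions with equal parameters and mass approach the same diffusion wave, both uniformly and in \<open>L\<^sup>1\<close>.
\<close>
lemma rescaled_solution_diff_Lp_tendsto_0:
  assumes c: "c > 0" and u0: "integrable lborel u0" "integrable lborel u0'"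
    and m: "(LINT x|lborel. u0 x) = m" "(LINT x|lborel. u0' x) = m" and p: "1 \<le> p"
  shows "((\<lambda>r. Lp_norm p (\<lambda>\<xi>. rescaled_solution b c u0 r \<xi> - rescaled_solution b c u0' r \<xi>)) \<longlongrightarrow> 0) at_top"
proof (rule order_tendstoI)
  fix y :: ennreal assume "0 < y"
  then obtain d0 where d0: "0 < d0" "ennreal d0 < y"
    by (metis dense ennreal_cases ennreal_less_zero_iff less_top_ennreal order.strict_trans2 top_greatest)
  define d where "d = min 1 d0"
  have "ennreal d \<le> ennreal d0" by (intro ennreal_leI) (simp add: d_def)
  then have "ennreal d < y" using d0(2) by (rule order.strict_trans1)
  moreover have "0 < d" "d \<le> 1" using d0(1) by (auto simp: d_def)
  ultimately have d: "0 < d" "d \<le> 1" "ennreal d < y" by simp_all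
  define q where "q = enn2real p"
  have dq: "d powr q / 2 > 0" "d / 2 > 0" using d by auto
  let ?W = "diffusion_wave b c m"
  show "\<forall>\<^sub>F r in at_top. Lp_norm p (\<lambda>\<xi>. rescaled_solution b c u0 r \<xi> - rescaled_solution b c u0' r \<xi>) < y"
    using rescaled_solution_uniform[OF c u0(1) m(1) dq(2), of b] rescaled_solution_uniform[OF c u0(2) m(2) dq(2), of b]
      rescaled_solution_L1[OF c u0(1) m(1) dq(1), of b] rescaled_solution_L1[OF c u0(2) m(2) dq(1), of b]
  proof eventually_elim
    case (elim r)
    note borel_measurable_rescaled_solution[OF u0(1), measurable] borel_measurable_rescaled_solution[OF u0(2), measurable]
    have [measurable]: "?W \<in> borel_measurable borel"
      by (intro borel_measurable_continuous_onI) (auto simp: continuous_on_eq_continuous_at isCont_diffusion_wave c)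
    have "Lp_norm p (\<lambda>\<xi>. rescaled_solution b c u0 r \<xi> - rescaled_solution b c u0' r \<xi>) \<le> ennreal d"
    proof (rule Lp_norm_le[OF p d(1,2)])
      show "\<bar>rescaled_solution b c u0 r \<xi> - rescaled_solution b c u0' r \<xi>\<bar> \<le> d" for \<xi>
        using elim(1)[rule_format, of \<xi>] elim(2)[rule_format, of \<xi>] by linarith
      have "(\<integral>\<^sup>+ \<xi>. ennreal \<bar>rescaled_solution b c u0 r \<xi> - rescaled_solution b c u0' r \<xi>\<bar> \<partial>lborel)
        \<le> (\<integral>\<^sup>+ \<xi>. ennreal \<bar>rescaled_solution b c u0 r \<xi> - ?W \<xi>\<bar> + ennreal \<bar>rescaled_solution b c u0' r \<xi> - ?W \<xi>\<bar> \<partial>lborel)"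
        by (intro nn_integral_mono) (auto simp flip: ennreal_plus intro!: ennreal_leI)
      also have "\<dots> = (\<integral>\<^sup>+ \<xi>. ennreal \<bar>rescaled_solution b c u0 r \<xi> - ?W \<xi>\<bar> \<partial>lborel) + (\<integral>\<^sup>+ \<xi>. ennreal \<bar>rescaled_solution b c u0' r \<xi> - ?W \<xi>\<bar> \<partial>lborel)"
        by (intro nn_integral_add) measurable
      also have "\<dots> \<le> ennreal (d powr q / 2) + ennreal (d powr q / 2)"
        by (intro add_mono elim)
      also have "\<dots> = ennreal (d powr enn2real p)"
        by (simp add: q_def flip: ennreal_plus)
      finally show "(\<integral>\<^sup>+ \<xi>. ennreal \<bar>rescaled_solution b c u0 r \<xi> - rescaled_solution b c u0' r \<xi>\<bar> \<partial>lborel) \<le> ennreal (d powr enn2real p)" .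
    qed
    then show ?case using d(3) by (rule order.strict_trans1)
  qed
qed simp

text \<open>
  For \<open>a = a'\<close> the two waves are distinct continuous functions, which differ on an interval. For
  \<open>a \<noteq> a'\<close> the drift carries the second wave off to infinity, where it vanishes, while the first stays.
\<close>
lemma diffusion_waves_separate:
  assumes c: "c > 0" "c' > 0" and m: "m \<noteq> 0" and ne: "(a, b, c) \<noteq> (a', b', c')"
  obtains e x0 l where "e > 0" "0 < l" "l \<le> 1"
    "\<forall>\<^sub>F r in at_top. \<forall>\<xi>\<in>{x0..x0 + l}. e \<le> \<bar>diffusion_wave b c m \<xi> - diffusion_wave b' c' m (\<xi> + (a - a') * r)\<bar>"
proof -
  let ?W = "diffusion_wave b c m" and ?W' = "diffusion_wave b' c' m"
  have nbhd: "\<exists>l. 0 < l \<and> l \<le> 1 \<and> (\<forall>\<xi>\<in>{x0..x0 + l}. \<bar>f x0\<bar> / 2 \<le> \<bar>f \<xi>\<bar>)"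
    if "isCont f x0" "f x0 \<noteq> 0" for f :: "real \<Rightarrow> real" and x0
  proof -
    have "eventually (\<lambda>\<xi>. dist (f \<xi>) (f x0) < \<bar>f x0\<bar> / 2) (at x0)"
      using that by (intro tendstoD) (auto simp: isCont_def)
    then obtain k where k: "k > 0" "\<And>\<xi>. \<xi> \<noteq> x0 \<Longrightarrow> dist \<xi> x0 < k \<Longrightarrow> dist (f \<xi>) (f x0) < \<bar>f x0\<bar> / 2"
      unfolding eventually_at by auto
    define l where "l = min 1 (k / 2)"
    have "\<bar>f x0\<bar> / 2 \<le> \<bar>f \<xi>\<bar>" if "\<xi> \<in> {x0..x0 + l}" for \<xi>
    proof (cases "\<xi> = x0")
      case False
      have "dist \<xi> x0 < k" using that k(1) by (auto simp: dist_real_def l_def)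
      then have "\<bar>f x0 - f \<xi>\<bar> < \<bar>f x0\<bar> / 2"
        using k(2)[OF False] by (simp add: dist_real_def abs_minus_commute)
      then show ?thesis using abs_triangle_ineq2[of "f x0" "f \<xi>"] by linarith
    qed simp
    then show ?thesis using k(1) by (intro exI[of _ l]) (auto simp: l_def)
  qed
  show thesis
  proof (cases "a = a'")
    case True
    have "?W \<noteq> ?W'" using diffusion_wave_determines_parameters[OF c m] ne True by blast
    then obtain x0 where x0: "?W x0 - ?W' x0 \<noteq> 0" by (auto simp: fun_eq_iff)
    have "isCont (\<lambda>\<xi>. ?W \<xi> - ?W' \<xi>) x0"
      by (intro continuous_intros isCont_diffusion_wave c)
    from nbhd[OF this x0] obtain l where l: "0 < l" "l \<le> 1"
      "\<forall>\<xi>\<in>{x0..x0 + l}. \<bar>?W x0 - ?W' x0\<bar> / 2 \<le> \<bar>?W \<xi> - ?W' \<xi>\<bar>" by blast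
    show thesis
      by (rule that[of "\<bar>?W x0 - ?W' x0\<bar> / 2" l x0]) (use l x0 True in auto)
  next
    case False
    have W0: "?W 0 \<noteq> 0"
      unfolding diffusion_wave_def using wave_mass_nonzero[OF c(1) m, of b] wave_denom_pos(3)[OF c(1), of b m 0]
      by simp
    from nbhd[OF isCont_diffusion_wave[OF c(1)] this] obtain l where l: "0 < l" "l \<le> 1"
      "\<forall>\<xi>\<in>{0..0 + l}. \<bar>?W 0\<bar> / 2 \<le> \<bar>?W \<xi>\<bar>" by blast
    define e where "e = \<bar>?W 0\<bar> / 4"
    have e: "e > 0" using W0 by (simp add: e_def)
    have "eventually (\<lambda>x. \<bar>?W' x\<bar> < e) at_top" "eventually (\<lambda>x. \<bar>?W' x\<bar> < e) at_bot"
      using order_tendstoD(2)[OF tendsto_rabs[OF diffusion_wave_tendsto_0(2)[OF c(2), of b' m]], of e]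
        order_tendstoD(2)[OF tendsto_rabs[OF diffusion_wave_tendsto_0(1)[OF c(2), of b' m]], of e] e by auto
    then obtain R1 R2 where R: "\<And>x. x \<ge> R1 \<Longrightarrow> \<bar>?W' x\<bar> < e" "\<And>x. x \<le> R2 \<Longrightarrow> \<bar>?W' x\<bar> < e"
      unfolding eventually_at_top_linorder eventually_at_bot_linorder by blast
    define R where "R = max \<bar>R1\<bar> \<bar>R2\<bar>"
    \<comment> \<open>The summand \<open>1\<close> absorbs \<open>\<xi>\<close>, which lies in \<open>[0, 1]\<close>.\<close>
    have "\<forall>\<^sub>F r in at_top. \<forall>\<xi>\<in>{0..0 + l}. e \<le> \<bar>?W \<xi> - ?W' (\<xi> + (a - a') * r)\<bar>"
      using eventually_ge_at_top[of "(R + 1) / \<bar>a - a'\<bar>"] eventually_ge_at_top[of 0]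
    proof eventually_elim
      case (elim r)
      show ?case
      proof
        fix \<xi> assume \<xi>: "\<xi> \<in> {0..0 + l}"
        have "R + 1 \<le> \<bar>(a - a') * r\<bar>"
          using elim False by (simp add: abs_mult pos_divide_le_eq mult.commute)
        then have "\<xi> + (a - a') * r \<ge> R1 \<or> \<xi> + (a - a') * r \<le> R2"
          using \<xi> l(2) unfolding R_def by auto
        then have "\<bar>?W' (\<xi> + (a - a') * r)\<bar> < e" using R by blast
        moreover have "2 * e \<le> \<bar>?W \<xi>\<bar>" using l(3) \<xi> by (simp add: e_def)
        ultimately show "e \<le> \<bar>?W \<xi> - ?W' (\<xi> + (a - a') * r)\<bar>" by linarith
      qed
    qed
    then show thesis using that[OF e l(1,2), of 0] by blast
  qed
qed

theorem theorem3:
  fixes a b c a' b' c' m :: real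
    and u0 u0' :: "real \<Rightarrow> real"
    and u u' :: "real \<Rightarrow> real \<Rightarrow> real"
  assumes "c > 0" and "c' > 0"
    and "integrable lborel u0" and "integrable lborel u0'"
    and "(LINT x|lborel. u0 x) = m" and "(LINT x|lborel. u0' x) = m" and "m \<noteq> 0"
    and "is_burgers_solution a b c u0 u"
    and "is_burgers_solution a' b' c' u0' u'"
  shows "((a, b, c) = (a', b', c') \<longleftrightarrow>
            (\<exists>p::ennreal. 1 \<le> p \<and> Liminf at_top (scaled_Lp_dist p u u') = 0)) \<and>
         ((\<exists>p::ennreal. 1 \<le> p \<and> Liminf at_top (scaled_Lp_dist p u u') = 0) \<longleftrightarrow>
            (\<forall>p::ennreal. 1 \<le> p \<longrightarrow> (scaled_Lp_dist p u u' \<longlongrightarrow> 0) at_top))"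
proof -
  have u: "u x t = cole_hopf a b c u0 x t" and u': "u' x t = cole_hopf a' b' c' u0' x t" if "t > 0" for x t
    using assms(8,9) that unfolding is_burgers_solution_def by blast+
  let ?D = "\<lambda>r \<xi>. rescaled_solution b c u0 r \<xi> - rescaled_solution b' c' u0' r (\<xi> + (a - a') * r)"
  have dist: "\<forall>\<^sub>F t in at_top. scaled_Lp_dist p u u' t = Lp_norm p (?D (sqrt t))" if "1 \<le> p" for p
    using eventually_gt_at_top[of 0]
  proof eventually_elim
    case (elim t)
    then show ?case
      using scaled_Lp_dist_burgers[where r="sqrt t", OF assms(1-4) u u' that] by simp
  qed
  have i_iii: "(scaled_Lp_dist p u u' \<longlongrightarrow> 0) at_top" if "(a, b, c) = (a', b', c')" "1 \<le> p" for p
  proof -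
    have "((\<lambda>r. Lp_norm p (?D r)) \<longlongrightarrow> 0) at_top"
      using rescaled_solution_diff_Lp_tendsto_0[OF assms(1,3-6) that(2), of b] that(1) by simp
    then have "((\<lambda>t. Lp_norm p (?D (sqrt t))) \<longlongrightarrow> 0) at_top"
      by (rule filterlim_compose[OF _ sqrt_at_top])
    then show ?thesis using tendsto_cong[OF dist[OF that(2)]] by simp
  qed
  have iii_ii: "Liminf at_top (scaled_Lp_dist 1 u u') = 0"
    if "\<forall>p::ennreal. 1 \<le> p \<longrightarrow> (scaled_Lp_dist p u u' \<longlongrightarrow> 0) at_top"
    using that by (intro lim_imp_Liminf) auto
  have ii_i: "(a, b, c) = (a', b', c')" if p: "1 \<le> p" and "Liminf at_top (scaled_Lp_dist p u u') = 0" for p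
  proof (rule ccontr)
    assume "(a, b, c) \<noteq> (a', b', c')"
    from assms(1,2,7) this obtain e x0 l where e: "e > 0" and l: "0 < l" "l \<le> 1" and sep:
      "\<forall>\<^sub>F r in at_top. \<forall>\<xi>\<in>{x0..x0 + l}. e \<le> \<bar>diffusion_wave b c m \<xi> - diffusion_wave b' c' m (\<xi> + (a - a') * r)\<bar>"
      by (rule diffusion_waves_separate)
    \<comment> \<open>Each solution may use up a third of the gap \<open>e\<close> between the waves.\<close>
    have e3: "e / 3 > 0" using e by simp
    have "\<forall>\<^sub>F r in at_top. ennreal (e / 3 * l) \<le> Lp_norm p (?D r)"
      using sep rescaled_solution_uniform[OF assms(1,3,5) e3, of b] rescaled_solution_uniform[OF assms(2,4,6) e3, of b']
    proof eventually_elim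
      case (elim r)
      show ?case
      proof (rule Lp_norm_ge[OF p e3 l])
        fix \<xi> assume "\<xi> \<in> {x0..x0 + l}"
        then show "e / 3 \<le> \<bar>?D r \<xi>\<bar>"
          using elim(1)[rule_format, of \<xi>] elim(2)[rule_format, of \<xi>]
            elim(3)[rule_format, of "\<xi> + (a - a') * r"] by linarith
      qed
    qed
    then have "\<forall>\<^sub>F t in at_top. ennreal (e / 3 * l) \<le> Lp_norm p (?D (sqrt t))"
      using sqrt_at_top unfolding filterlim_iff by blast
    with dist[OF p] have "\<forall>\<^sub>F t in at_top. ennreal (e / 3 * l) \<le> scaled_Lp_dist p u u' t"
      by eventually_elim simp
    then have "ennreal (e / 3 * l) \<le> Liminf at_top (scaled_Lp_dist p u u')"
      by (rule Liminf_bounded)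
    then show False using that(2) e l by (simp add: ennreal_eq_0_iff mult_le_0_iff)
  qed
  show ?thesis using i_iii iii_ii ii_i by blast
qed

end
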